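(* Let $\Gamma=(V,E)$ be a graph. For each prime power $q$, $$\mathsf F_\Gamma(q,Y)=\sum_{i=0}^\infty \operatorname{cc}_{q^i}(\mathbf G_\Gamma(\mathbf F_q))\,Y^i$$ (as an equality of polynomials in $Y$), where $\mathsf F_\Gamma(X,Y)$ is the class-size polynomial of $\Gamma$ and $\mathbf G_\Gamma(\mathbf F_q)$ is the graphical group associated with $\Gamma$ over the finite field $\mathbf F_q$.
   Context: Graphs are finite, simple, and have at least one vertex; $\sim$ denotes adjacency; rings are associative, commutative, and unital; group commutators are $[x,y]=x^{-1}y^{-1}xy$. Graphical groups: let $\Gamma=(V,E)$ be a graph with vertices $V=\{v_1,\dotsc,v_n\}$ and let $J=\{(j,k):1\le j<k\le n,\ v_j\sim v_k\}$. For a ring $R$, $\mathbf G_\Gamma(R)$ is the group generated by symbols $x_1(r),\dotsc,x_n(r)$ and $z_{jk}(r)$ for $(j,k)\in J$, $r\in R$, subject to the defining relations (for all $i,i'\in\{1,\dotsc,n\}$, $(j,k),(j',k')\in J$, $r,r'\in R$): $x_i(r)x_i(r')=x_i(r+r')$ and $z_{jk}(r)z_{jk}(r')=z_{jk}(r+r')$; $[x_j(r),x_k(r')]=z_{jk}(rr')$; $[x_i(r),x_{i'}(r')]=1$ if $v_i\not\sim v_{i'}$; $[x_i(r),z_{jk}(r')]=[z_{j'k'}(r),z_{jk}(r')]=1$. (The isomorphism type does not depend on the ordering of the vertices.) For a finite group $G$, $\operatorname{cc}_e(G)$ is the number of conjugacy classes of $G$ of size $e$. For $U\subseteq V$ (not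 necessarily proper), $\Gamma[U]$ is the induced subgraph with vertex set $U$, $\operatorname c_\Gamma(U)$ is the number of connected components of $\Gamma[U]$ (with $\operatorname c_\Gamma(\emptyset)=0$), and $\operatorname N_\Gamma[U]$ is the closed neighbourhood of $U$, i.e. the set of all vertices that lie in $U$ or are adjacent to an element of $U$ (so $\operatorname N_\Gamma[\emptyset]=\emptyset$). If $m$ is the number of edges of $\Gamma$, the class-size polynomial is $$\mathsf F_\Gamma(X,Y)=\sum_{U\subseteq V}(X-1)^{|U|}\,X^{m+\operatorname c_\Gamma(U)-|\operatorname N_\Gamma[U]|}\,Y^{|\operatorname N_\Gamma[U]|-\operatorname c_\Gamma(U)}\in\mathbf Z[X,Y].$$ *)

theory Defs
  imports
    "HOL-Algebra.Group_Action"
    "HOL-Algebra.Ring"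
    "HOL-Computational_Algebra.Polynomial"
    "HOL-Number_Theory.Prime_Powers"
    "HOL-Library.Groups_Big_Fun"
begin

section \<open>Groups given by generators and relations\<close>

text \<open>The letter \<open>(s, True)\<close> stands for the generator \<open>s\<close>, and \<open>(s, False)\<close> for its inverse.\<close>

type_synonym 'g word = "('g \<times> bool) list"

definition words_on :: "'g set \<Rightarrow> 'g word set" where
  "words_on S = lists (S \<times> UNIV)"

definition word_gen :: "'g \<Rightarrow> 'g word" where
  "word_gen s = [(s, True)]"

definition word_inv :: "'g word \<Rightarrow> 'g word" where
  "word_inv w = rev (map (\<lambda>(s, b). (s, \<not> b)) w)"

definition word_comm :: "'g word \<Rightarrow> 'g word \<Rightarrow> 'g word" where
  "word_comm x y = word_inv x @ word_inv y @ x @ y"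

text \<open>
  A pair \<open>(l, r) \<in> Rel\<close> stands for the relation \<open>l = r\<close>. The following is the least congruence on
  the monoid of words over \<open>S\<close> that contains all relations and makes \<open>s\<close> and its formal inverse
  cancel.
\<close>

inductive word_eq :: "'g set \<Rightarrow> ('g word \<times> 'g word) set \<Rightarrow> 'g word \<Rightarrow> 'g word \<Rightarrow> bool"
  for S :: "'g set" and Rel :: "('g word \<times> 'g word) set" where
  refl: "w \<in> words_on S \<Longrightarrow> word_eq S Rel w w"
| sym: "word_eq S Rel v w \<Longrightarrow> word_eq S Rel w v"
| trans: "word_eq S Rel u v \<Longrightarrow> word_eq S Rel v w \<Longrightarrow> word_eq S Rel u w"
| cancel: "u \<in> words_on S \<Longrightarrow> v \<in> words_on S \<Longrightarrow> s \<in> S \<Longrightarrow>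
    word_eq S Rel (u @ [(s, b), (s, \<not> b)] @ v) (u @ v)"
| rel: "u \<in> words_on S \<Longrightarrow> v \<in> words_on S \<Longrightarrow> (l, r) \<in> Rel \<Longrightarrow>
    word_eq S Rel (u @ l @ v) (u @ r @ v)"

definition word_rel :: "'g set \<Rightarrow> ('g word \<times> 'g word) set \<Rightarrow> 'g word rel" where
  "word_rel S Rel = {(v, w). word_eq S Rel v w}"

definition presented_group ::
  "'g set \<Rightarrow> ('g word \<times> 'g word) set \<Rightarrow> 'g word set monoid" where
  "presented_group S Rel =
     \<lparr> carrier = words_on S // word_rel S Rel,
       monoid.mult = (\<lambda>A B. \<Union>a\<in>A. \<Union>b\<in>B. word_rel S Rel `` {a @ b}),
       one = word_rel S Rel `` {[]} \<rparr>"

lemma words_on_simps [simp]: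
  "[] \<in> words_on S"
  "x # w \<in> words_on S \<longleftrightarrow> fst x \<in> S \<and> w \<in> words_on S"
  "v @ w \<in> words_on S \<longleftrightarrow> v \<in> words_on S \<and> w \<in> words_on S"
  "word_gen s \<in> words_on S \<longleftrightarrow> s \<in> S"
  by (auto simp: words_on_def word_gen_def mem_Times_iff)

lemma word_inv_in_words_on [simp]: "word_inv w \<in> words_on S \<longleftrightarrow> w \<in> words_on S"
  by (auto simp: words_on_def word_inv_def lists_eq_set mem_Times_iff image_iff split: prod.splits)

lemma word_comm_in_words_on [simp]:
  "word_comm v w \<in> words_on S \<longleftrightarrow> v \<in> words_on S \<and> w \<in> words_on S"
  by (auto simp: word_comm_def)

context
  fixes S :: "'g set" and Rel :: "('g word \<times> 'g word) set"
  assumes Rel: "Rel \<subseteq> words_on S \<times> words_on S"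
begin

lemma word_eq_in_words_on:
  "word_eq S Rel v w \<Longrightarrow> v \<in> words_on S \<and> w \<in> words_on S"
  by (induction rule: word_eq.induct) (use Rel in auto)

lemma word_eq_append_left:
  "word_eq S Rel v w \<Longrightarrow> u \<in> words_on S \<Longrightarrow> word_eq S Rel (u @ v) (u @ w)"
proof (induction rule: word_eq.induct)
  case (cancel u' v s b)
  then show ?case using word_eq.cancel[of "u @ u'" S v s Rel b] by simp
next
  case (rel u' v l r)
  then show ?case using word_eq.rel[of "u @ u'" S v l r Rel] by simp
qed (auto intro: word_eq.intros)

lemma word_eq_append_right:
  "word_eq S Rel v w \<Longrightarrow> u \<in> words_on S \<Longrightarrow> word_eq S Rel (v @ u) (w @ u)"
proof (induction rule: word_eq.induct)
  case (cancel u' v s b)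
  then show ?case using word_eq.cancel[of u' S "v @ u" s Rel b] by simp
next
  case (rel u' v l r)
  then show ?case using word_eq.rel[of u' S "v @ u" l r Rel] by simp
qed (auto intro: word_eq.intros)

lemma word_eq_append:
  "word_eq S Rel v v' \<Longrightarrow> word_eq S Rel w w' \<Longrightarrow> word_eq S Rel (v @ w) (v' @ w')"
  by (meson word_eq.trans word_eq_append_left word_eq_append_right word_eq_in_words_on)

lemma equiv_word_rel: "equiv (words_on S) (word_rel S Rel)"
  by (intro equivI refl_onI symI transI)
     (auto simp: word_rel_def dest: word_eq_in_words_on intro: word_eq.intros)

lemma presented_group_mult:
  assumes "v \<in> words_on S" "w \<in> words_on S"
  shows "(word_rel S Rel `` {v}) \<otimes>\<^bsub>presented_group S Rel\<^esub> (word_rel S Rel `` {w})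
           = word_rel S Rel `` {v @ w}"
proof -
  have "congruent2 (word_rel S Rel) (word_rel S Rel) (\<lambda>v w. word_rel S Rel `` {v @ w})"
    unfolding congruent2_def
    by (auto intro!: equiv_class_eq[OF equiv_word_rel])
       (auto simp: word_rel_def intro: word_eq_append)
  from UN_equiv_class2[OF equiv_word_rel equiv_word_rel this] show ?thesis
    using assms by (simp add: presented_group_def)
qed

lemma word_eq_inv_left: "w \<in> words_on S \<Longrightarrow> word_eq S Rel (word_inv w @ w) []"
proof (induction w)
  case Nil
  then show ?case by (simp add: word_inv_def word_eq.refl)
next
  case (Cons x w)
  obtain s b where x: "x = (s, b)" by (cases x)
  have "word_eq S Rel (word_inv w @ [(s, \<not> b), (s, \<not> \<not> b)] @ w) (word_inv w @ w)"
    using Cons.prems x by (intro word_eq.cancel) auto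
  with Cons x show ?case by (auto simp: word_inv_def intro: word_eq.trans)
qed

lemma group_presented_group: "group (presented_group S Rel)"
proof (rule groupI)
  note carr = presented_group_def quotient_def
  show "\<one>\<^bsub>presented_group S Rel\<^esub> \<in> carrier (presented_group S Rel)"
    by (auto simp: carr)
next
  fix A B assume "A \<in> carrier (presented_group S Rel)" "B \<in> carrier (presented_group S Rel)"
  then obtain a b where "a \<in> words_on S" "b \<in> words_on S"
    "A = word_rel S Rel `` {a}" "B = word_rel S Rel `` {b}"
    by (auto simp: presented_group_def elim!: quotientE)
  then show "A \<otimes>\<^bsub>presented_group S Rel\<^esub> B \<in> carrier (presented_group S Rel)"
    by (simp add: presented_group_mult) (auto simp: presented_group_def intro: quotientI)
next
  fix A B C assume "A \<in> carrier (presented_group S Rel)" "B \<in> carrier (presented_group S Rel)"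
    "C \<in> carrier (presented_group S Rel)"
  then obtain a b c where "a \<in> words_on S" "b \<in> words_on S" "c \<in> words_on S"
    "A = word_rel S Rel `` {a}" "B = word_rel S Rel `` {b}" "C = word_rel S Rel `` {c}"
    by (auto simp: presented_group_def elim!: quotientE)
  then show "A \<otimes>\<^bsub>presented_group S Rel\<^esub> B \<otimes>\<^bsub>presented_group S Rel\<^esub> C =
    A \<otimes>\<^bsub>presented_group S Rel\<^esub> (B \<otimes>\<^bsub>presented_group S Rel\<^esub> C)"
    by (simp add: presented_group_mult)
next
  fix A assume "A \<in> carrier (presented_group S Rel)"
  then obtain a where a: "a \<in> words_on S" "A = word_rel S Rel `` {a}"
    by (auto simp: presented_group_def elim!: quotientE)
  have one: "\<one>\<^bsub>presented_group S Rel\<^esub> = word_rel S Rel `` {[]}"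
    by (simp add: presented_group_def)
  show "\<one>\<^bsub>presented_group S Rel\<^esub> \<otimes>\<^bsub>presented_group S Rel\<^esub> A = A"
    using a by (simp add: one presented_group_mult)
  show "\<exists>B\<in>carrier (presented_group S Rel). B \<otimes>\<^bsub>presented_group S Rel\<^esub> A = \<one>\<^bsub>presented_group S Rel\<^esub>"
  proof (rule bexI)
    show "word_rel S Rel `` {word_inv a} \<in> carrier (presented_group S Rel)"
      using a by (auto simp: presented_group_def intro: quotientI)
    have "(word_inv a @ a, []) \<in> word_rel S Rel"
      using a word_eq_inv_left by (simp add: word_rel_def)
    then show "word_rel S Rel `` {word_inv a} \<otimes>\<^bsub>presented_group S Rel\<^esub> A = \<one>\<^bsub>presented_group S Rel\<^esub>"
      using a by (simp add: one presented_group_mult equiv_class_eq[OF equiv_word_rel])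
  qed
qed

end


section \<open>Graphs\<close>

definition finite_simple_graph :: "'v set \<Rightarrow> 'v set set \<Rightarrow> bool" where
  "finite_simple_graph V E \<longleftrightarrow>
     finite V \<and> V \<noteq> {} \<and> E \<subseteq> {{u, w} | u w. u \<in> V \<and> w \<in> V \<and> u \<noteq> w}"

definition induced_edges :: "'v set set \<Rightarrow> 'v set \<Rightarrow> 'v set set" where
  "induced_edges E U = {e \<in> E. e \<subseteq> U}"

definition connected_components :: "'v set \<Rightarrow> 'v set set \<Rightarrow> 'v set set" where
  "connected_components V E = V // {(u, w). {u, w} \<in> E}\<^sup>*"

definition num_components :: "'v set set \<Rightarrow> 'v set \<Rightarrow> nat" where
  "num_components E U = card (connected_components U (induced_edges E U))"

definition closed_nbhd :: "'v set \<Rightarrow> 'v set set \<Rightarrow> 'v set \<Rightarrow> 'v set" where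
  "closed_nbhd V E U = {w \<in> V. w \<in> U \<or> (\<exists>u\<in>U. {u, w} \<in> E)}"


section \<open>Graphical groups\<close>

datatype 'r graphical_gen = XGen nat 'r | ZGen nat nat 'r

text \<open>
  The enumeration \<open>v\<close> lists the vertices as \<open>v 1, \<dots>, v n\<close>.
\<close>

definition edge_indices :: "nat \<Rightarrow> (nat \<Rightarrow> 'v) \<Rightarrow> 'v set set \<Rightarrow> (nat \<times> nat) set" where
  "edge_indices n v E = {(j, k). 1 \<le> j \<and> j < k \<and> k \<le> n \<and> {v j, v k} \<in> E}"

definition graphical_gens ::
  "nat \<Rightarrow> (nat \<Rightarrow> 'v) \<Rightarrow> 'v set set \<Rightarrow> ('r, 'm) ring_scheme \<Rightarrow> 'r graphical_gen set" where
  "graphical_gens n v E R =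
     {XGen i r | i r. i \<in> {1..n} \<and> r \<in> carrier R} \<union>
     {ZGen j k r | j k r. (j, k) \<in> edge_indices n v E \<and> r \<in> carrier R}"

definition graphical_rels ::
  "nat \<Rightarrow> (nat \<Rightarrow> 'v) \<Rightarrow> 'v set set \<Rightarrow> ('r, 'm) ring_scheme \<Rightarrow>
   ('r graphical_gen word \<times> 'r graphical_gen word) set" where
  "graphical_rels n v E R =
    (let J = edge_indices n v E;
         x = (\<lambda>i r. word_gen (XGen i r));
         z = (\<lambda>j k r. word_gen (ZGen j k r))
     in {(x i r @ x i r', x i (r \<oplus>\<^bsub>R\<^esub> r')) | i r r'.
           i \<in> {1..n} \<and> r \<in> carrier R \<and> r' \<in> carrier R} \<union>
        {(z j k r @ z j k r', z j k (r \<oplus>\<^bsub>R\<^esub> r')) | j k r r'.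
           (j, k) \<in> J \<and> r \<in> carrier R \<and> r' \<in> carrier R} \<union>
        {(word_comm (x j r) (x k r'), z j k (r \<otimes>\<^bsub>R\<^esub> r')) | j k r r'.
           (j, k) \<in> J \<and> r \<in> carrier R \<and> r' \<in> carrier R} \<union>
        {(word_comm (x i r) (x i' r'), []) | i i' r r'.
           i \<in> {1..n} \<and> i' \<in> {1..n} \<and> {v i, v i'} \<notin> E \<and> r \<in> carrier R \<and> r' \<in> carrier R} \<union>
        {(word_comm (x i r) (z j k r'), []) | i j k r r'.
           i \<in> {1..n} \<and> (j, k) \<in> J \<and> r \<in> carrier R \<and> r' \<in> carrier R} \<union>
        {(word_comm (z j' k' r) (z j k r'), []) | j' k' j k r r'.
           (j', k') \<in> J \<and> (j, k) \<in> J \<and> r \<in> carrier R \<and> r' \<in> carrier R})"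

definition graphical_group ::
  "nat \<Rightarrow> (nat \<Rightarrow> 'v) \<Rightarrow> 'v set set \<Rightarrow> ('r, 'm) ring_scheme \<Rightarrow> 'r graphical_gen word set monoid" where
  "graphical_group n v E R = presented_group (graphical_gens n v E R) (graphical_rels n v E R)"

lemma graphical_rels_in_words_on:
  assumes "ring R"
  shows "graphical_rels n v E R \<subseteq>
    words_on (graphical_gens n v E R) \<times> words_on (graphical_gens n v E R)"
proof -
  interpret ring R by fact
  show ?thesis by (auto simp: graphical_rels_def graphical_gens_def edge_indices_def Let_def)
qed

lemma group_graphical_group: "ring R \<Longrightarrow> group (graphical_group n v E R)"
  unfolding graphical_group_def by (intro group_presented_group graphical_rels_in_words_on)


section \<open>Conjugacy classes\<close>

definition conjugacy_classes :: "('a, 'b) monoid_scheme \<Rightarrow> 'a set set" where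
  "conjugacy_classes G =
     orbits G (carrier G) (\<lambda>g. \<lambda>h\<in>carrier G. g \<otimes>\<^bsub>G\<^esub> h \<otimes>\<^bsub>G\<^esub> inv\<^bsub>G\<^esub> g)"

definition cc :: "nat \<Rightarrow> ('a, 'b) monoid_scheme \<Rightarrow> nat" where
  "cc e G = card {C \<in> conjugacy_classes G. card C = e}"


section \<open>The class-size polynomial\<close>

text \<open>
  Elements of \<open>\<int>[X, Y]\<close> are represented as polynomials in \<open>Y\<close> whose coefficients are polynomials
  in \<open>X\<close>; thus \<open>[:0, 1:]\<close> is \<open>X\<close>, and \<open>monom p k\<close> is \<open>p Y\<^sup>k\<close>. The truncated subtractions are
  harmless: \<open>\<Gamma>[N[U]]\<close> has a spanning forest with \<open>c(U)\<close> components and hence with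
  \<open>|N[U]| - c(U) \<le> m\<close> edges, and \<open>c(U) \<le> |U| \<le> |N[U]|\<close>.
\<close>

definition class_size_poly :: "'v set \<Rightarrow> 'v set set \<Rightarrow> int poly poly" where
  "class_size_poly V E =
     (let m = card E; X = [:0, 1:] in
      \<Sum>U\<in>Pow V.
        monom ((X - 1) ^ card U * X ^ (m + num_components E U - card (closed_nbhd V E U)))
              (card (closed_nbhd V E U) - num_components E U))"

definition eval_X :: "int \<Rightarrow> int poly poly \<Rightarrow> int poly" where
  "eval_X a F = map_poly (\<lambda>p. poly p a) F"

end

theory Submission
  imports Defs "HOL-Algebra.Generated_Groups"
begin

text \<open>
  Collecting generators into an ordered product \<open>x\<^sub>1(a\<^sub>1) \<dots> x\<^sub>n(a\<^sub>n) \<Prod> z\<^sub>j\<^sub>k(c\<^sub>j\<^sub>k)\<close> shows that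
  \<open>G\<^sub>\<Gamma>(F)\<close> has at most \<open>q\<^sup>n\<^sup>+\<^sup>m\<close> elements. It maps onto the group of pairs \<open>(a, c) \<in> F\<^sup>V \<times> F\<^sup>E\<close> with
  \<open>(a, c)(b, d) = (a + b, c + d + (a\<^sub>j b\<^sub>k)\<^sub>j\<^sub>k)\<close>, which has exactly that many, so the two are isomorphic.
  In this model \<open>(b, d)\<close> commutes with \<open>(a, c)\<close> iff \<open>a\<^sub>u b\<^sub>w = a\<^sub>w b\<^sub>u\<close> for all edges \<open>uw\<close>.
  If \<open>U\<close> is the support of \<open>a\<close>, then \<open>b\<close> is a scalar multiple of \<open>a\<close> on each component of \<open>\<Gamma>[U]\<close>,
  vanishes on \<open>N[U] - U\<close> and is free elsewhere. Orbit-stabiliser gives the class size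
  \<open>q\<close> to the power \<open>|N[U]| - c(U)\<close>, and \<open>(q - 1)\<^bsup>|U|\<^esup> q\<^sup>m\<close> elements have support \<open>U\<close>.
\<close>

section \<open>Groups given by generators and relations\<close>

text \<open>Uniqueness of the collected form is never proved inside the group given by relations.
  Only existence is proved there, which bounds the order from above; a surjection onto a group of
  exactly that order is then forced to be injective. The term a_j b_k of the model, taken only for j
  < k, is a bilinear 2-cocycle. Bilinearity gives associativity, and the antisymmetrisation a_j b_k
  - a_k b_j is the commutator. Using this antisymmetric form itself as the cocycle would double all
  commutators and hence kill them in characteristic 2. Classes are counted through their elements.
  The first coordinate is constant on a class, so U is an invariant of the class, and the number of
  classes belonging to U is the number (q - 1)^|U| q^m of elements divided by the common class size.
  This quotient is the coefficient that U contributes to the polynomial, with exponent m + c(U) -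
  |N[U]| of q.\<close>

definition eval_word :: "('a, 'm) monoid_scheme \<Rightarrow> ('g \<Rightarrow> 'a) \<Rightarrow> 'g word \<Rightarrow> 'a" where
  "eval_word G f w =
     foldr (\<lambda>(s, b) x. (if b then f s else inv\<^bsub>G\<^esub> f s) \<otimes>\<^bsub>G\<^esub> x) w \<one>\<^bsub>G\<^esub>"

lemma eval_word_simps [simp]:
  "eval_word G f [] = \<one>\<^bsub>G\<^esub>"
  "eval_word G f ((s, b) # w) = (if b then f s else inv\<^bsub>G\<^esub> f s) \<otimes>\<^bsub>G\<^esub> eval_word G f w"
  by (simp_all add: eval_word_def)

context group
begin

lemma eval_word_closed:
  "f \<in> S \<rightarrow> carrier G \<Longrightarrow> w \<in> words_on S \<Longrightarrow> eval_word G f w \<in> carrier G"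
proof (induction w)
  case (Cons x w)
  then show ?case by (cases x) (auto simp: Pi_iff)
qed auto

lemma eval_word_append:
  assumes "f \<in> S \<rightarrow> carrier G" "v \<in> words_on S" "w \<in> words_on S"
  shows "eval_word G f (v @ w) = eval_word G f v \<otimes> eval_word G f w"
  using assms by (induction v) (auto simp: eval_word_closed m_assoc Pi_iff)

lemma eval_word_gen:
  assumes "f \<in> S \<rightarrow> carrier G" "s \<in> S"
  shows "eval_word G f (word_gen s) = f s"
  using assms by (auto simp: word_gen_def Pi_iff)

lemma eval_word_inv:
  assumes f: "f \<in> S \<rightarrow> carrier G" and w: "w \<in> words_on S"
  shows "eval_word G f (word_inv w) = inv (eval_word G f w)"
  using w
proof (induction w)
  case Nil
  then show ?case by (simp add: word_inv_def)
next
  case (Cons x w)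
  obtain s b where x: "x = (s, b)" by (cases x)
  have s: "s \<in> S" "f s \<in> carrier G" and w: "w \<in> words_on S" using Cons.prems f x by auto
  have "word_inv (x # w) = word_inv w @ [(s, \<not> b)]" by (simp add: word_inv_def x)
  moreover have "word_inv w \<in> words_on S" using w by simp
  ultimately have "eval_word G f (word_inv (x # w)) = inv (eval_word G f w) \<otimes> eval_word G f [(s, \<not> b)]"
    using Cons.IH[OF w] s by (simp add: eval_word_append[OF f])
  then show ?case
    using s eval_word_closed[OF f w] by (cases b) (simp_all add: x inv_mult_group)
qed

lemma eval_word_comm:
  assumes f: "f \<in> S \<rightarrow> carrier G" and "v \<in> words_on S" "w \<in> words_on S"
  shows "eval_word G f (word_comm v w) =
    inv (eval_word G f v) \<otimes> inv (eval_word G f w) \<otimes> eval_word G f v \<otimes> eval_word G f w"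
proof -
  have "eval_word G f v \<in> carrier G" "eval_word G f w \<in> carrier G"
    using assms eval_word_closed[OF f] by auto
  then show ?thesis
    using assms by (simp add: word_comm_def eval_word_append[OF f] eval_word_inv[OF f] m_assoc)
qed

text \<open>Evaluation is multiplicative, so an elementary step in the middle of a word can be
  checked on the replaced factor alone; symmetry and transitivity are inherited from
  equality.\<close>

lemma eval_word_respects_word_eq:
  assumes f: "f \<in> S \<rightarrow> carrier G"
    and Rel: "Rel \<subseteq> words_on S \<times> words_on S"
    and rels: "\<And>l r. (l, r) \<in> Rel \<Longrightarrow> eval_word G f l = eval_word G f r"
    and "word_eq S Rel v w"
  shows "eval_word G f v = eval_word G f w"
  using assms(4)
proof (induction rule: word_eq.induct)
  case (cancel u v s b)
  have s: "f s \<in> carrier G" and v: "eval_word G f v \<in> carrier G"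
    using cancel f eval_word_closed[OF f] by auto
  have "eval_word G f ([(s, b), (s, \<not> b)] @ v) = eval_word G f v"
    using s v by (auto simp: m_assoc[symmetric])
  then show ?case
    using cancel by (simp add: eval_word_append[OF f] del: append_Cons)
next
  case (rel u v l r)
  then have "l \<in> words_on S" "r \<in> words_on S" using Rel by auto
  then show ?case
    using rel by (simp add: eval_word_append[OF f] rels)
qed auto

text \<open>Von Dyck's theorem, the universal property of a presentation. The value on words is
  recorded as well, since it identifies the images of the generators later.\<close>

lemma presented_group_lift:
  assumes f: "f \<in> S \<rightarrow> carrier G"
    and Rel: "Rel \<subseteq> words_on S \<times> words_on S"
    and rels: "\<And>l r. (l, r) \<in> Rel \<Longrightarrow> eval_word G f l = eval_word G f r"
  obtains \<psi> where "\<psi> \<in> hom (presented_group S Rel) G"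
    and "\<And>w. w \<in> words_on S \<Longrightarrow> \<psi> (word_rel S Rel `` {w}) = eval_word G f w"
proof
  \<comment> \<open>Elements of the presented group are sets of words on which evaluation is
    constant, so the image is a singleton and no representative has to be chosen.\<close>
  let ?\<psi> = "\<lambda>A. the_elem (eval_word G f ` A)"
  show eval: "?\<psi> (word_rel S Rel `` {w}) = eval_word G f w" if "w \<in> words_on S" for w
  proof -
    have "eval_word G f u = eval_word G f w" if "u \<in> word_rel S Rel `` {w}" for u
      using eval_word_respects_word_eq[OF f Rel rels, of w u] that by (simp add: word_rel_def)
    moreover have "w \<in> word_rel S Rel `` {w}"
      using word_eq.refl[OF that, of Rel] by (simp add: word_rel_def)
    ultimately have "eval_word G f ` (word_rel S Rel `` {w}) = {eval_word G f w}"
      by blast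
    then show ?thesis by simp
  qed
  show "?\<psi> \<in> hom (presented_group S Rel) G"
  proof (rule homI)
    fix A B assume A: "A \<in> carrier (presented_group S Rel)" and B: "B \<in> carrier (presented_group S Rel)"
    then obtain a b where "a \<in> words_on S" "b \<in> words_on S"
      "A = word_rel S Rel `` {a}" "B = word_rel S Rel `` {b}"
      by (auto simp: presented_group_def elim!: quotientE)
    then show "?\<psi> A \<in> carrier G" "?\<psi> (A \<otimes>\<^bsub>presented_group S Rel\<^esub> B) = ?\<psi> A \<otimes> ?\<psi> B"
      using f by (simp_all add: eval presented_group_mult[OF Rel] eval_word_append eval_word_closed[OF f])
  qed
qed

end

context
  fixes S :: "'g set" and Rel :: "('g word \<times> 'g word) set"
  assumes Rel: "Rel \<subseteq> words_on S \<times> words_on S"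
begin

abbreviation "presented_gen s \<equiv> word_rel S Rel `` {word_gen s}"

interpretation P: group "presented_group S Rel"
  by (rule group_presented_group[OF Rel])

lemma presented_gen_closed: "presented_gen \<in> S \<rightarrow> carrier (presented_group S Rel)"
  by (auto simp: presented_group_def intro: quotientI)

text \<open>The tautological evaluation. Through it the relations become equations between values of
  \<open>eval_word\<close>, the same form in which they are checked in the model.\<close>

lemma eval_word_presented_gen:
  assumes "w \<in> words_on S"
  shows "eval_word (presented_group S Rel) presented_gen w = word_rel S Rel `` {w}"
  using assms
proof (induction w)
  case Nil
  then show ?case by (simp add: presented_group_def)
next
  case (Cons x w)
  obtain s b where x: "x = (s, b)" by (cases x)
  have s: "s \<in> S" and w: "w \<in> words_on S" using Cons.prems x by auto
  have "(if b then presented_gen s else inv\<^bsub>presented_group S Rel\<^esub> presented_gen s)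
      = word_rel S Rel `` {[(s, b)]}"
  proof (cases b)
    case False
    \<comment> \<open>\<open>cancel\<close> with \<open>b = False\<close> puts the inverse letter on
      the left, which is the side that \<open>inv_equality\<close> asks for.\<close>
    have "word_eq S Rel ([] @ [(s, False), (s, \<not> False)] @ []) ([] @ [])"
      using s by (intro word_eq.cancel) auto
    then have "word_rel S Rel `` {[(s, False)] @ word_gen s} = \<one>\<^bsub>presented_group S Rel\<^esub>"
      using equiv_class_eq[OF equiv_word_rel[OF Rel], of "[(s, False)] @ word_gen s" "[]"]
      by (simp add: word_rel_def presented_group_def word_gen_def)
    then have "word_rel S Rel `` {[(s, False)]} \<otimes>\<^bsub>presented_group S Rel\<^esub> presented_gen s
       = \<one>\<^bsub>presented_group S Rel\<^esub>"
      using s by (subst presented_group_mult[OF Rel]) auto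
    moreover have "word_rel S Rel `` {[(s, False)]} \<in> carrier (presented_group S Rel)"
      using s by (auto simp: presented_group_def intro!: quotientI)
    ultimately show ?thesis
      using False P.inv_equality presented_gen_closed s by auto
  qed (simp add: word_gen_def)
  then show ?case
    using s w by (simp add: x Cons.IH presented_group_mult[OF Rel])
qed

lemma presented_group_rel:
  assumes "(l, r) \<in> Rel"
  shows "eval_word (presented_group S Rel) presented_gen l =
    eval_word (presented_group S Rel) presented_gen r"
proof -
  have "word_eq S Rel ([] @ l @ []) ([] @ r @ [])"
    using assms by (intro word_eq.rel) auto
  then have "word_rel S Rel `` {l} = word_rel S Rel `` {r}"
    by (intro equiv_class_eq[OF equiv_word_rel[OF Rel]]) (simp add: word_rel_def)
  then show ?thesis
    using assms Rel by (auto simp: eval_word_presented_gen)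
qed

lemma generate_presented_gen:
  "generate (presented_group S Rel) (presented_gen ` S) = carrier (presented_group S Rel)"
proof
  have sub: "presented_gen ` S \<subseteq> carrier (presented_group S Rel)"
    using presented_gen_closed by auto
  then show "generate (presented_group S Rel) (presented_gen ` S) \<subseteq> carrier (presented_group S Rel)"
    by (rule P.generate_incl)
  have "eval_word (presented_group S Rel) presented_gen w
      \<in> generate (presented_group S Rel) (presented_gen ` S)" if "w \<in> words_on S" for w
    using that
  proof (induction w)
    case (Cons x w)
    then show ?case
      by (cases x) (auto intro: generate.intros)
  qed (simp add: generate.one)
  then show "carrier (presented_group S Rel) \<subseteq> generate (presented_group S Rel) (presented_gen ` S)"
    by (auto simp: presented_group_def eval_word_presented_gen elim!: quotientE)
       (metis eval_word_presented_gen presented_group_def)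
qed

end

section \<open>Collecting factors into an ordered product\<close>

lemma (in group) generate_subset_absorbing:
  assumes "A \<subseteq> carrier G" "B \<subseteq> carrier G" "\<one> \<in> A"
    and mult: "\<And>x h. x \<in> A \<Longrightarrow> h \<in> B \<Longrightarrow> x \<otimes> h \<in> A"
    and inv: "\<And>h. h \<in> B \<Longrightarrow> inv h \<in> B"
  shows "generate G B \<subseteq> A"
proof
  fix h assume h: "h \<in> generate G B"
  \<comment> \<open>\<open>A\<close> is not known to be a subgroup, so membership of
    \<open>h\<close> alone would not pass to products. Absorption of \<open>h\<close> from the right
    does, and \<open>x = \<one>\<close> recovers membership.\<close>
  have "\<forall>x\<in>A. x \<otimes> h \<in> A"
    using h
  proof (induction rule: generate.induct)
    case (eng h1 h2)
    then have "h1 \<in> carrier G" "h2 \<in> carrier G"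
      using generate_incl[OF assms(2)] by auto
    then show ?case
      using eng assms(1) by (simp add: m_assoc[symmetric] subset_iff)
  qed (use assms in auto)
  then show "h \<in> A"
    using assms(3) h generate_incl[OF assms(2)] by force
qed

text \<open>Collecting a factor into an ordered product costs only elements of the central subgroup \<open>C\<close>.\<close>

lemma (in group) collect_into_ordered_product:
  fixes X :: "'i \<Rightarrow> 'r \<Rightarrow> 'a"
  assumes C: "subgroup C G" and central: "\<And>c x. c \<in> C \<Longrightarrow> x \<in> carrier G \<Longrightarrow> c \<otimes> x = x \<otimes> c"
    and X: "\<And>i r. i \<in> I \<Longrightarrow> r \<in> K \<Longrightarrow> X i r \<in> carrier G"
    and add: "\<And>i r s. i \<in> I \<Longrightarrow> r \<in> K \<Longrightarrow> s \<in> K \<Longrightarrow> X i r \<otimes> X i s = X i (oplus r s)"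
    and swap: "\<And>i j r s. i \<in> I \<Longrightarrow> j \<in> I \<Longrightarrow> i \<noteq> j \<Longrightarrow> r \<in> K \<Longrightarrow> s \<in> K \<Longrightarrow>
      \<exists>c\<in>C. X i r \<otimes> X j s = X j s \<otimes> X i r \<otimes> c"
    and "distinct is" "set is \<subseteq> I" "i \<in> set is"
    and oplus: "\<And>r s. r \<in> K \<Longrightarrow> s \<in> K \<Longrightarrow> oplus r s \<in> K" and a: "a \<in> I \<rightarrow> K" and r: "r \<in> K"
  shows "\<exists>c\<in>C. foldl (\<lambda>x i. x \<otimes> X i (a i)) \<one> is \<otimes> X i r =
    foldl (\<lambda>x j. x \<otimes> X j ((a(i := oplus (a i) r)) j)) \<one> is \<otimes> c"
  using assms(6-8)
proof (induction "is" rule: rev_induct)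
  case Nil
  then show ?case by simp
next
  case (snoc m js)
  let ?P = "\<lambda>a js. foldl (\<lambda>x i. x \<otimes> X i (a i)) \<one> js"
  let ?a = "a(i := oplus (a i) r)"
  have closed: "?P b js \<in> carrier G" if "set js \<subseteq> I" "b \<in> I \<rightarrow> K" for b js
    using that by (induction js rule: rev_induct) (auto intro!: X simp: Pi_iff)
  have a': "?a \<in> I \<rightarrow> K" using a oplus r by (auto simp: Pi_iff)
  have m: "m \<in> I" "a m \<in> K" "X m (a m) \<in> carrier G" and js: "?P a js \<in> carrier G"
    using snoc.prems a closed[OF _ a] X by (auto simp: Pi_iff)
  show ?case
  \<comment> \<open>If \<open>i\<close> is the last index, distinctness keeps it out of
    \<open>js\<close>, so only the last factor changes. Otherwise \<open>X i r\<close> moves left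
    past the last factor at the cost of \<open>d\<close>, is absorbed by the induction hypothesis at
    the cost of \<open>c\<close>, and both costs are pushed to the right end.\<close>
  proof (cases "i = m")
    case True
    then have "?P ?a js = ?P a js"
      using snoc.prems by (intro foldl_cong) auto
    moreover have "X m r \<in> carrier G" using m r X by auto
    ultimately show ?thesis
      using True m js r oplus X
      by (auto simp: m_assoc add intro!: bexI[OF _ subgroup.one_closed[OF C]])
  next
    case False
    then have i: "i \<in> set js" "i \<in> I" using snoc.prems by auto
    obtain c where c: "c \<in> C" "?P a js \<otimes> X i r = ?P ?a js \<otimes> c"
      using snoc i by auto
    obtain d where d: "d \<in> C" "X m (a m) \<otimes> X i r = X i r \<otimes> X m (a m) \<otimes> d"
      using swap[of m i "a m" r] False i m r by auto
    have cd: "c \<in> carrier G" "d \<in> carrier G" "X i r \<in> carrier G"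
      using c d C subgroup.subset i r X by blast+
    have "?P ?a js \<in> carrier G"
      using closed[of js ?a] a' snoc.prems by auto
    then have "?P a js \<otimes> X m (a m) \<otimes> X i r = ?P ?a js \<otimes> (c \<otimes> X m (a m)) \<otimes> d"
    proof -
      have "?P a js \<otimes> X m (a m) \<otimes> X i r = (?P a js \<otimes> X i r) \<otimes> X m (a m) \<otimes> d"
        using d cd m js by (simp add: m_assoc)
      then show ?thesis
        unfolding c(2) using \<open>?P ?a js \<in> carrier G\<close> cd m by (simp add: m_assoc)
    qed
    also have "\<dots> = ?P ?a js \<otimes> X m (a m) \<otimes> (c \<otimes> d)"
      using central[OF c(1) m(3)] cd m \<open>?P ?a js \<in> carrier G\<close> by (simp add: m_assoc)
    finally show ?thesis
      using False subgroup.m_closed[OF C c(1) d(1)] by auto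
  qed
qed

section \<open>Conjugacy classes\<close>

text \<open>A plain image, free of the restriction built into the conjugation action, so that
  homomorphisms can be pushed through it.\<close>

definition conj_class :: "('a, 'b) monoid_scheme \<Rightarrow> 'a \<Rightarrow> 'a set" where
  "conj_class G h = (\<lambda>g. g \<otimes>\<^bsub>G\<^esub> h \<otimes>\<^bsub>G\<^esub> inv\<^bsub>G\<^esub> g) ` carrier G"

lemma orbit_conjugation:
  assumes "h \<in> carrier G"
  shows "orbit G (\<lambda>g. \<lambda>h\<in>carrier G. g \<otimes>\<^bsub>G\<^esub> h \<otimes>\<^bsub>G\<^esub> inv\<^bsub>G\<^esub> g) h = conj_class G h"
  using assms by (auto simp: orbit_def conj_class_def)

lemma conjugacy_classes_eq: "conjugacy_classes G = conj_class G ` carrier G"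
  unfolding conjugacy_classes_def orbits_def setcompr_eq_image Collect_mem_eq
  by (rule image_cong[OF HOL.refl orbit_conjugation])

lemma (in group) conj_class_subset: "h \<in> carrier G \<Longrightarrow> conj_class G h \<subseteq> carrier G"
  by (auto simp: conj_class_def)

text \<open>Taking images carries classes to classes. It is injective on classes and preserves their
  sizes because every class lies in the carrier, where the isomorphism is injective.\<close>

lemma cc_iso:
  assumes "group G" "group H" and iso: "\<psi> \<in> iso G H"
  shows "cc e G = cc e H"
proof -
  interpret G: group G by fact
  interpret H: group H by fact
  interpret group_hom G H \<psi>
    using iso by unfold_locales (auto simp: iso_def)
  have bij: "bij_betw \<psi> (carrier G) (carrier H)" using iso by (simp add: iso_def)
  then have inj: "inj_on \<psi> (carrier G)" and surj: "\<psi> ` carrier G = carrier H"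
    by (auto simp: bij_betw_def)
  have cls: "conj_class H (\<psi> h) = \<psi> ` conj_class G h" if "h \<in> carrier G" for h
    using that unfolding conj_class_def surj[symmetric] image_image by (intro image_cong) auto
  have sub: "C \<subseteq> carrier G" if "C \<in> conjugacy_classes G" for C
    using that G.conj_class_subset by (auto simp: conjugacy_classes_eq)
  have card: "card (\<psi> ` C) = card C" if "C \<in> conjugacy_classes G" for C
    using card_image inj_on_subset[OF inj sub[OF that]] by blast
  have "conjugacy_classes H = image \<psi> ` conjugacy_classes G"
    unfolding conjugacy_classes_eq surj[symmetric] image_image by (intro image_cong) (auto simp: cls)
  then have "{C \<in> conjugacy_classes H. card C = e} = image \<psi> ` {C \<in> conjugacy_classes G. card C = e}"
    using card by auto
  moreover have "inj_on (image \<psi>) {C \<in> conjugacy_classes G. card C = e}"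
    by (rule inj_on_subset[OF inj_on_image_Pow[OF inj]]) (use sub in auto)
  ultimately show ?thesis
    by (simp add: cc_def card_image)
qed

text \<open>Double counting: the classes of size \<open>e\<close> are disjoint and cover exactly the
  elements whose class has that size. The product form avoids a division; for \<open>e = 0\<close>
  both sides vanish.\<close>

lemma (in group) card_conj_class_times_cc:
  assumes "finite (carrier G)"
  shows "e * cc e G = card {g \<in> carrier G. card (conj_class G g) = e}"
proof -
  let ?\<phi> = "\<lambda>g. \<lambda>h\<in>carrier G. g \<otimes> h \<otimes> inv g"
  interpret group_action G "carrier G" ?\<phi> by (rule action_by_conjugation)
  have mem: "h \<in> conj_class G h" if "h \<in> carrier G" for h
    using orbit_refl[OF that] that by (simp add: orbit_conjugation)
  have part: "partition (carrier G) (conjugacy_classes G)"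
    using orbit_partition by (simp add: conjugacy_classes_def)
  have eq: "C = conj_class G h" if "C \<in> conjugacy_classes G" "h \<in> C" for C h
  proof -
    have h: "h \<in> carrier G" using that part by (auto simp: partition_def)
    then have "\<exists>!D. D \<in> conjugacy_classes G \<and> h \<in> D"
      using part by (auto simp: partition_def)
    moreover have "conj_class G h \<in> conjugacy_classes G"
      using h by (simp add: conjugacy_classes_eq)
    ultimately show ?thesis
      using that mem[OF h] by blast
  qed
  let ?\<C> = "{C \<in> conjugacy_classes G. card C = e}"
  have "finite (conjugacy_classes G)"
    using assms by (simp add: conjugacy_classes_eq)
  moreover have un: "\<Union>?\<C> = {g \<in> carrier G. card (conj_class G g) = e}" (is "_ = ?S")
  proof (intro equalityI subsetI)
    fix h assume "h \<in> \<Union>?\<C>"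
    then obtain C where C: "C \<in> conjugacy_classes G" "card C = e" "h \<in> C" by blast
    then have "h \<in> carrier G" using part by (auto simp: partition_def)
    then show "h \<in> ?S" using C eq[OF C(1,3)] by simp
  next
    fix h assume "h \<in> ?S"
    then show "h \<in> \<Union>?\<C>"
      using mem by (intro UnionI[of "conj_class G h"]) (simp_all add: conjugacy_classes_eq)
  qed
  moreover have "finite (\<Union>?\<C>)" unfolding un using assms by simp
  moreover have "C1 \<inter> C2 = {}" if "C1 \<in> ?\<C>" "C2 \<in> ?\<C>" "C1 \<noteq> C2" for C1 C2
    using that eq[of C1] eq[of C2] by auto
  ultimately have "e * card ?\<C> = card (\<Union>?\<C>)"
    by (intro card_partition) simp_all
  then show ?thesis by (simp add: cc_def un)
qed

text \<open>Clears the inverses from a commutator relation, so that checking one in the model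
  requires products only.\<close>

lemma (in group) commutator_eq_iff:
  assumes "x \<in> carrier G" "y \<in> carrier G" "z \<in> carrier G"
  shows "inv x \<otimes> inv y \<otimes> x \<otimes> y = z \<longleftrightarrow> x \<otimes> y = y \<otimes> x \<otimes> z"
proof -
  have "inv x \<otimes> inv y \<otimes> x \<otimes> y = inv (y \<otimes> x) \<otimes> (x \<otimes> y)"
    using assms by (simp add: inv_mult_group m_assoc)
  then show ?thesis
    using assms inv_solve_left[of z "y \<otimes> x" "x \<otimes> y"] by auto
qed

section \<open>A concrete model of the graphical group\<close>

locale graphical = field F for F :: "('r, 'm) ring_scheme" (structure) +
  fixes V :: "'v set" and E :: "'v set set" and n :: nat and v :: "nat \<Rightarrow> 'v"
  assumes graph: "finite_simple_graph V E"
    and enum: "bij_betw v {1..n} V"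
    and finite_carrier: "finite (carrier F)"
begin

abbreviation "J \<equiv> edge_indices n v E"

text \<open>The second coordinate is indexed by \<open>J\<close> and not by edges, because the
  product uses the order of the endpoints. Extensional functions are determined by their values on
  the index set, which gives the carrier its exact size.\<close>

definition model :: "(('v \<Rightarrow> 'r) \<times> (nat \<times> nat \<Rightarrow> 'r)) monoid" where
  "model =
    \<lparr> carrier = (V \<rightarrow>\<^sub>E carrier F) \<times> (J \<rightarrow>\<^sub>E carrier F),
      monoid.mult = (\<lambda>(a, c) (b, d).
        (\<lambda>u\<in>V. a u \<oplus> b u,
         \<lambda>p\<in>J. c p \<oplus> d p \<oplus> a (v (fst p)) \<otimes> b (v (snd p)))),
      one = (\<lambda>u\<in>V. \<zero>, \<lambda>p\<in>J. \<zero>) \<rparr>"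

lemma model_simps:
  "carrier model = (V \<rightarrow>\<^sub>E carrier F) \<times> (J \<rightarrow>\<^sub>E carrier F)"
  "(a, c) \<otimes>\<^bsub>model\<^esub> (b, d) =
    (\<lambda>u\<in>V. a u \<oplus> b u, \<lambda>p\<in>J. c p \<oplus> d p \<oplus> a (v (fst p)) \<otimes> b (v (snd p)))"
  "\<one>\<^bsub>model\<^esub> = (\<lambda>u\<in>V. \<zero>, \<lambda>p\<in>J. \<zero>)"
  by (simp_all add: model_def)

lemma v_in_V: "i \<in> {1..n} \<Longrightarrow> v i \<in> V"
  using enum by (auto simp: bij_betw_def)

lemma J_D:
  assumes "p \<in> J"
  shows "fst p \<in> {1..n}" "snd p \<in> {1..n}" "fst p < snd p" "v (fst p) \<in> V" "v (snd p) \<in> V"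
    "{v (fst p), v (snd p)} \<in> E"
  using assms v_in_V by (auto simp: edge_indices_def)

lemma J_irrefl [simp]: "(i, i) \<notin> J"
  by (simp add: edge_indices_def)

lemma v_eq_iff: "i \<in> {1..n} \<Longrightarrow> j \<in> {1..n} \<Longrightarrow> v i = v j \<longleftrightarrow> i = j"
  by (rule inj_on_eq_iff[OF bij_betw_imp_inj_on[OF enum]])

lemma finite_V: "finite V" and finite_J: "finite J"
proof -
  show "finite V" using graph by (simp add: finite_simple_graph_def)
  have "J \<subseteq> {1..n} \<times> {1..n}" by (auto simp: edge_indices_def)
  then show "finite J" by (rule finite_subset) simp
qed

lemma group_model: "group model"
proof (rule groupI)
  fix x y z assume "x \<in> carrier model" "y \<in> carrier model" "z \<in> carrier model"
  then obtain a c b d e f where x: "x = (a, c)" "y = (b, d)" "z = (e, f)"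
    and *: "a \<in> V \<rightarrow>\<^sub>E carrier F" "b \<in> V \<rightarrow>\<^sub>E carrier F" "e \<in> V \<rightarrow>\<^sub>E carrier F"
    "c \<in> J \<rightarrow>\<^sub>E carrier F" "d \<in> J \<rightarrow>\<^sub>E carrier F" "f \<in> J \<rightarrow>\<^sub>E carrier F"
    by (auto simp: model_simps)
  have V: "a u \<in> carrier F" "b u \<in> carrier F" "e u \<in> carrier F" if "u \<in> V" for u
    using * that by (auto elim: PiE_mem)
  have J: "c p \<in> carrier F" "d p \<in> carrier F" "f p \<in> carrier F" if "p \<in> J" for p
    using * that by (auto elim: PiE_mem)
  show "x \<otimes>\<^bsub>model\<^esub> y \<in> carrier model"
    using V J J_D(4,5) by (simp add: x model_simps)
  have "a u \<oplus> b u \<oplus> e u = a u \<oplus> (b u \<oplus> e u)" if "u \<in> V" for u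
    using V[OF that] by algebra
  \<comment> \<open>The cocycle identity: by bilinearity both bracketings collect the products of
    \<open>a\<close> with \<open>b\<close>, of \<open>a\<close> with \<open>e\<close> and of
    \<open>b\<close> with \<open>e\<close>.\<close>
  moreover have "c p \<oplus> d p \<oplus> a (v (fst p)) \<otimes> b (v (snd p)) \<oplus> f p \<oplus>
      (a (v (fst p)) \<oplus> b (v (fst p))) \<otimes> e (v (snd p)) =
      c p \<oplus> (d p \<oplus> f p \<oplus> b (v (fst p)) \<otimes> e (v (snd p))) \<oplus>
      a (v (fst p)) \<otimes> (b (v (snd p)) \<oplus> e (v (snd p)))" if "p \<in> J" for p
    using V[OF J_D(4)[OF that]] V[OF J_D(5)[OF that]] J[OF that] by algebra
  ultimately show "x \<otimes>\<^bsub>model\<^esub> y \<otimes>\<^bsub>model\<^esub> z = x \<otimes>\<^bsub>model\<^esub> (y \<otimes>\<^bsub>model\<^esub> z)"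
    using J_D(4,5) by (auto simp: x model_simps intro!: restrict_ext)
next
  show "\<one>\<^bsub>model\<^esub> \<in> carrier model" by (simp add: model_simps)
next
  fix x assume "x \<in> carrier model"
  then obtain a c where x: "x = (a, c)" and *: "a \<in> V \<rightarrow>\<^sub>E carrier F" "c \<in> J \<rightarrow>\<^sub>E carrier F"
    by (auto simp: model_simps)
  have V: "a u \<in> carrier F" if "u \<in> V" for u
    using * that by (auto elim: PiE_mem)
  have J: "c p \<in> carrier F" if "p \<in> J" for p
    using * that by (auto elim: PiE_mem)
  show "\<one>\<^bsub>model\<^esub> \<otimes>\<^bsub>model\<^esub> x = x"
    using * V J J_D(4,5) by (auto simp: x model_simps intro!: PiE_ext[OF _ *(1)] PiE_ext[OF _ *(2)])
  show "\<exists>y\<in>carrier model. y \<otimes>\<^bsub>model\<^esub> x = \<one>\<^bsub>model\<^esub>"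
  proof
    \<comment> \<open>The cocycle takes the value - a_j a_k on the pair (-a, a); the extra product
      in the second coordinate compensates for it.\<close>
    let ?y = "(\<lambda>u\<in>V. \<ominus> a u, \<lambda>p\<in>J. \<ominus> c p \<oplus> a (v (fst p)) \<otimes> a (v (snd p)))"
    show "?y \<in> carrier model"
      using V J J_D(4,5) by (simp add: model_simps)
    have "\<ominus> c p \<oplus> a (v (fst p)) \<otimes> a (v (snd p)) \<oplus> c p \<oplus> \<ominus> a (v (fst p)) \<otimes> a (v (snd p)) = \<zero>"
      if "p \<in> J" for p
      using V[OF J_D(4)[OF that]] V[OF J_D(5)[OF that]] J[OF that] by algebra
    then show "?y \<otimes>\<^bsub>model\<^esub> x = \<one>\<^bsub>model\<^esub>"
      using V J_D(4,5) by (auto simp: x model_simps l_neg intro!: restrict_ext)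
  qed
qed

sublocale M: group model by (rule group_model)

definition x_model :: "nat \<Rightarrow> 'r \<Rightarrow> ('v \<Rightarrow> 'r) \<times> (nat \<times> nat \<Rightarrow> 'r)" where
  "x_model i r = (\<lambda>u\<in>V. if u = v i then r else \<zero>, \<lambda>p\<in>J. \<zero>)"

definition z_model :: "nat \<Rightarrow> nat \<Rightarrow> 'r \<Rightarrow> ('v \<Rightarrow> 'r) \<times> (nat \<times> nat \<Rightarrow> 'r)" where
  "z_model j k r = (\<lambda>u\<in>V. \<zero>, \<lambda>p\<in>J. if p = (j, k) then r else \<zero>)"

lemma x_model_closed: "r \<in> carrier F \<Longrightarrow> x_model i r \<in> carrier model"
  and z_model_closed: "r \<in> carrier F \<Longrightarrow> z_model j k r \<in> carrier model"
  by (simp_all add: x_model_def z_model_def model_simps)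

lemma if_zero_simps:
  assumes "r \<in> carrier F" "s \<in> carrier F"
  shows "(if b then r else \<zero>) \<oplus> (if b then s else \<zero>) = (if b then r \<oplus> s else \<zero>)"
    and "(if b then r else \<zero>) \<otimes> (if c then s else \<zero>) = (if b \<and> c then r \<otimes> s else \<zero>)"
  using assms by simp_all

text \<open>The second coordinate can record a trace only at \<open>(i, j)\<close>, in that order.
  The relations among the \<open>x_model\<close> therefore differ only in which of
  \<open>(i, j)\<close> and \<open>(j, i)\<close> belongs to \<open>J\<close>: neither for equal
  indices or non-adjacent vertices, exactly one for an edge.\<close>

lemma x_model_mult:
  assumes "r \<in> carrier F" "s \<in> carrier F" "i \<in> {1..n}" "j \<in> {1..n}"
  shows "x_model i r \<otimes>\<^bsub>model\<^esub> x_model j s =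
    (\<lambda>u\<in>V. (if u = v i then r else \<zero>) \<oplus> (if u = v j then s else \<zero>),
     \<lambda>p\<in>J. if p = (i, j) then r \<otimes> s else \<zero>)"
proof -
  have "v (fst p) = v i \<longleftrightarrow> fst p = i" "v (snd p) = v j \<longleftrightarrow> snd p = j" if "p \<in> J" for p
    using J_D[OF that] assms(3,4) v_eq_iff by auto
  then show ?thesis
    using assms(1,2) J_D(4,5)
    by (simp add: x_model_def model_simps prod_eq_iff[of _ "(i, j)"] if_zero_simps cong: restrict_cong)
qed

lemma x_model_add:
  assumes "r \<in> carrier F" "s \<in> carrier F" "i \<in> {1..n}"
  shows "x_model i r \<otimes>\<^bsub>model\<^esub> x_model i s = x_model i (r \<oplus> s)"
proof -
  have "p \<noteq> (i, i)" if "p \<in> J" for p using that by auto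
  then show ?thesis
    using assms(1,2)
    unfolding x_model_mult[OF assms assms(3)] by (simp add: x_model_def if_zero_simps cong: restrict_cong)
qed

lemma z_model_add:
  assumes "r \<in> carrier F" "s \<in> carrier F"
  shows "z_model j k r \<otimes>\<^bsub>model\<^esub> z_model j k s = z_model j k (r \<oplus> s)"
  using assms J_D(4,5) by (simp add: z_model_def model_simps if_zero_simps cong: restrict_cong)

lemma x_model_commutator:
  assumes "r \<in> carrier F" "s \<in> carrier F" "(j, k) \<in> J"
  shows "x_model j r \<otimes>\<^bsub>model\<^esub> x_model k s =
    x_model k s \<otimes>\<^bsub>model\<^esub> x_model j r \<otimes>\<^bsub>model\<^esub> z_model j k (r \<otimes> s)"
proof -
  have jk: "j \<in> {1..n}" "k \<in> {1..n}" "(k, j) \<notin> J"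
    using assms(3) by (auto simp: edge_indices_def)
  then have "p \<noteq> (k, j)" if "p \<in> J" for p using that by auto
  then show ?thesis
    using assms(1,2) J_D(4,5)
    unfolding x_model_mult[OF assms(1,2) jk(1,2)] x_model_mult[OF assms(2,1) jk(2,1)]
    by (simp add: z_model_def model_simps a_comm cong: restrict_cong)
qed

lemma x_model_commute:
  assumes "r \<in> carrier F" "s \<in> carrier F" "i \<in> {1..n}" "j \<in> {1..n}" "{v i, v j} \<notin> E"
  shows "x_model i r \<otimes>\<^bsub>model\<^esub> x_model j s = x_model j s \<otimes>\<^bsub>model\<^esub> x_model i r"
proof -
  have "p \<noteq> (i, j)" "p \<noteq> (j, i)" if "p \<in> J" for p
    using assms(5) that by (auto simp: edge_indices_def insert_commute)
  then show ?thesis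
    unfolding x_model_mult[OF assms(1-4)] x_model_mult[OF assms(2,1,4,3)]
    using assms(1,2) by (simp add: a_comm cong: restrict_cong)
qed

text \<open>A zero first coordinate kills the cocycle term on either side.\<close>

lemma z_model_central:
  assumes "r \<in> carrier F" "x \<in> carrier model"
  shows "x \<otimes>\<^bsub>model\<^esub> z_model j k r = z_model j k r \<otimes>\<^bsub>model\<^esub> x"
proof -
  obtain a c where x: "x = (a, c)" by (cases x)
  then have ac: "a \<in> V \<rightarrow>\<^sub>E carrier F" "c \<in> J \<rightarrow>\<^sub>E carrier F"
    using assms(2) by (auto simp: model_simps)
  have "a u \<in> carrier F" if "u \<in> V" for u using ac(1) that by (rule PiE_mem)
  moreover have "c p \<in> carrier F" if "p \<in> J" for p using ac(2) that by (rule PiE_mem)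
  ultimately show ?thesis
    using assms(1) J_D(4,5) by (simp add: x z_model_def model_simps a_comm cong: restrict_cong)
qed

end

section \<open>Normal forms\<close>

text \<open>The elements commuting with a fixed one form a subgroup. This is applied twice, once to
  each generating set.\<close>

lemma (in group) generate_commute:
  assumes "A \<subseteq> carrier G" "B \<subseteq> carrier G"
    and comm: "\<And>a b. a \<in> A \<Longrightarrow> b \<in> B \<Longrightarrow> a \<otimes> b = b \<otimes> a"
    and "x \<in> generate G A" "y \<in> generate G B"
  shows "x \<otimes> y = y \<otimes> x"
proof -
  have *: "x \<otimes> b = b \<otimes> x" if A: "A \<subseteq> carrier G" and b: "b \<in> carrier G"
    and comm: "\<And>a. a \<in> A \<Longrightarrow> a \<otimes> b = b \<otimes> a" and x: "x \<in> generate G A" for A b x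
  proof -
    have "subgroup {x \<in> carrier G. x \<otimes> b = b \<otimes> x} G"
    proof (rule subgroupI)
      fix x assume "x \<in> {x \<in> carrier G. x \<otimes> b = b \<otimes> x}"
      then have x: "x \<in> carrier G" and xb: "x \<otimes> b = b \<otimes> x" by auto
      \<comment> \<open>Inserting \<open>x \<otimes> inv x\<close> on the right creates the factor
        \<open>b \<otimes> x\<close> to which commutation applies.\<close>
      have "inv x \<otimes> b = inv x \<otimes> (b \<otimes> x) \<otimes> inv x" using x b by (simp add: m_assoc)
      also have "\<dots> = b \<otimes> inv x" unfolding xb[symmetric] using x b by (simp add: m_assoc[symmetric])
      finally show "inv x \<in> {x \<in> carrier G. x \<otimes> b = b \<otimes> x}" using x by simp
    next
      fix x y assume "x \<in> {x \<in> carrier G. x \<otimes> b = b \<otimes> x}" "y \<in> {x \<in> carrier G. x \<otimes> b = b \<otimes> x}"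
      then have x: "x \<in> carrier G" "x \<otimes> b = b \<otimes> x" and y: "y \<in> carrier G" "y \<otimes> b = b \<otimes> y" by auto
      have "x \<otimes> y \<otimes> b = x \<otimes> b \<otimes> y" using x(1) y b by (simp add: m_assoc)
      also have "\<dots> = b \<otimes> (x \<otimes> y)" using x y(1) b by (simp add: m_assoc)
      finally show "x \<otimes> y \<in> {x \<in> carrier G. x \<otimes> b = b \<otimes> x}" using x y by simp
    next
      have "\<one> \<in> {x \<in> carrier G. x \<otimes> b = b \<otimes> x}" using b by simp
      then show "{x \<in> carrier G. x \<otimes> b = b \<otimes> x} \<noteq> {}" by blast
    qed auto
    then have "generate G A \<subseteq> {x \<in> carrier G. x \<otimes> b = b \<otimes> x}"
      using A comm by (intro generate_subgroup_incl) auto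
    then show ?thesis using x by auto
  qed
  have "x \<in> carrier G" using assms(4) generate_incl[OF assms(1)] by auto
  have "b \<otimes> x = x \<otimes> b" if "b \<in> B" for b
    by (rule *[OF assms(1) _ _ assms(4), symmetric]) (use comm that assms(2) in auto)
  then show ?thesis
    using *[OF assms(2) \<open>x \<in> carrier G\<close> _ assms(5)] by simp
qed

section \<open>Relations as identities between generators\<close>

context graphical
begin

abbreviation "gens \<equiv> graphical_gens n v E F"
abbreviation "rels \<equiv> graphical_rels n v E F"
abbreviation "G \<equiv> graphical_group n v E F"

sublocale GG: group G
  by (rule group_graphical_group[OF ring_axioms])

lemmas rels_in_words = graphical_rels_in_words_on[OF ring_axioms, of n v E]

definition gen :: "'r graphical_gen \<Rightarrow> 'r graphical_gen word set" where
  "gen = presented_gen gens rels"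

abbreviation "x_gen i r \<equiv> gen (XGen i r)"
text \<open>A pair as index gives the central generators the same shape as \<open>x_gen\<close>, so
  that one collecting lemma serves both kinds.\<close>

abbreviation "z_gen p r \<equiv> gen (ZGen (fst p) (snd p) r)"

lemma gen_closed: "gen \<in> gens \<rightarrow> carrier G"
  using presented_gen_closed[OF rels_in_words] by (simp add: gen_def graphical_group_def)

lemma generate_gen: "generate G (gen ` gens) = carrier G"
  using generate_presented_gen[OF rels_in_words] by (simp add: gen_def graphical_group_def)

lemma gen_rel:
  assumes "(l, r) \<in> rels"
  shows "eval_word G gen l = eval_word G gen r"
  using presented_group_rel[OF rels_in_words assms] by (simp add: gen_def graphical_group_def)

lemma XGen_in_gens [simp]: "XGen i r \<in> gens \<longleftrightarrow> i \<in> {1..n} \<and> r \<in> carrier F"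
  and ZGen_in_gens [simp]: "ZGen j k r \<in> gens \<longleftrightarrow> (j, k) \<in> J \<and> r \<in> carrier F"
  by (auto simp: graphical_gens_def)

lemma x_gen_closed: "i \<in> {1..n} \<Longrightarrow> r \<in> carrier F \<Longrightarrow> x_gen i r \<in> carrier G"
  and z_gen_closed: "p \<in> J \<Longrightarrow> r \<in> carrier F \<Longrightarrow> z_gen p r \<in> carrier G"
  using funcset_mem[OF gen_closed] by auto

text \<open>The two families that make the \<open>ZGen\<close> commute with everything are merged
  into one over all of \<open>gens\<close>, so that case analyses treat them together.\<close>

lemma graphical_rels_iff:
  "(l, w) \<in> rels \<longleftrightarrow>
    (\<exists>i\<in>{1..n}. \<exists>r\<in>carrier F. \<exists>s\<in>carrier F.
      l = word_gen (XGen i r) @ word_gen (XGen i s) \<and> w = word_gen (XGen i (r \<oplus> s))) \<or>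
    (\<exists>p\<in>J. \<exists>r\<in>carrier F. \<exists>s\<in>carrier F.
      l = word_gen (ZGen (fst p) (snd p) r) @ word_gen (ZGen (fst p) (snd p) s) \<and>
      w = word_gen (ZGen (fst p) (snd p) (r \<oplus> s))) \<or>
    (\<exists>p\<in>J. \<exists>r\<in>carrier F. \<exists>s\<in>carrier F.
      l = word_comm (word_gen (XGen (fst p) r)) (word_gen (XGen (snd p) s)) \<and>
      w = word_gen (ZGen (fst p) (snd p) (r \<otimes> s))) \<or>
    (\<exists>i\<in>{1..n}. \<exists>j\<in>{1..n}. \<exists>r\<in>carrier F. \<exists>s\<in>carrier F. {v i, v j} \<notin> E \<and>
      l = word_comm (word_gen (XGen i r)) (word_gen (XGen j s)) \<and> w = []) \<or>
    (\<exists>t\<in>gens. \<exists>p\<in>J. \<exists>r\<in>carrier F.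
      l = word_comm (word_gen t) (word_gen (ZGen (fst p) (snd p) r)) \<and> w = [])"
proof -
  have ex_gens: "(\<exists>t\<in>gens. P t) \<longleftrightarrow> (\<exists>i\<in>{1..n}. \<exists>r\<in>carrier F. P (XGen i r)) \<or>
      (\<exists>p\<in>J. \<exists>r\<in>carrier F. P (ZGen (fst p) (snd p) r))" for P
    unfolding graphical_gens_def Bex_def split_paired_Ex fst_conv snd_conv by blast
  show ?thesis
    unfolding ex_gens
    unfolding graphical_rels_def Let_def Un_iff mem_Collect_eq prod.inject disj_assoc
    unfolding Bex_def split_paired_Ex fst_conv snd_conv
    by (intro arg_cong2[where f = "(\<or>)"]; blast)
qed

lemma x_gen_add:
  assumes "i \<in> {1..n}" "r \<in> carrier F" "s \<in> carrier F"
  shows "x_gen i r \<otimes>\<^bsub>G\<^esub> x_gen i s = x_gen i (r \<oplus> s)"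
proof -
  have "(word_gen (XGen i r) @ word_gen (XGen i s), word_gen (XGen i (r \<oplus> s))) \<in> rels"
    unfolding graphical_rels_iff by (rule disjI1, rule bexI, rule bexI, rule bexI, rule conjI, rule HOL.refl, rule HOL.refl) (rule assms)+
  from gen_rel[OF this] show ?thesis
    using assms by (simp add: GG.eval_word_append[OF gen_closed] GG.eval_word_gen[OF gen_closed])
qed

lemma z_gen_add:
  assumes "p \<in> J" "r \<in> carrier F" "s \<in> carrier F"
  shows "z_gen p r \<otimes>\<^bsub>G\<^esub> z_gen p s = z_gen p (r \<oplus> s)"
proof -
  have "(word_gen (ZGen (fst p) (snd p) r) @ word_gen (ZGen (fst p) (snd p) s),
      word_gen (ZGen (fst p) (snd p) (r \<oplus> s))) \<in> rels"
    unfolding graphical_rels_iff by (rule disjI2, rule disjI1, rule bexI, rule bexI, rule bexI, rule conjI, rule HOL.refl, rule HOL.refl) (rule assms)+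
  from gen_rel[OF this] show ?thesis
    using assms by (simp add: GG.eval_word_append[OF gen_closed] GG.eval_word_gen[OF gen_closed])
qed

lemma gen_word_comm:
  assumes "s \<in> gens" "t \<in> gens"
  shows "eval_word G gen (word_comm (word_gen s) (word_gen t)) =
    inv\<^bsub>G\<^esub> gen s \<otimes>\<^bsub>G\<^esub> inv\<^bsub>G\<^esub> gen t \<otimes>\<^bsub>G\<^esub> gen s \<otimes>\<^bsub>G\<^esub> gen t"
  using assms by (simp add: GG.eval_word_comm[OF gen_closed] GG.eval_word_gen[OF gen_closed])

lemma x_gen_commutator:
  assumes "p \<in> J" "r \<in> carrier F" "s \<in> carrier F"
  shows "x_gen (fst p) r \<otimes>\<^bsub>G\<^esub> x_gen (snd p) s =
    x_gen (snd p) s \<otimes>\<^bsub>G\<^esub> x_gen (fst p) r \<otimes>\<^bsub>G\<^esub> z_gen p (r \<otimes> s)"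
proof -
  have "(word_comm (word_gen (XGen (fst p) r)) (word_gen (XGen (snd p) s)),
      word_gen (ZGen (fst p) (snd p) (r \<otimes> s))) \<in> rels"
    unfolding graphical_rels_iff by (rule disjI2, rule disjI2, rule disjI1, rule bexI, rule bexI, rule bexI, rule conjI, rule HOL.refl, rule HOL.refl) (rule assms)+
  from gen_rel[OF this]
  have "inv\<^bsub>G\<^esub> x_gen (fst p) r \<otimes>\<^bsub>G\<^esub> inv\<^bsub>G\<^esub> x_gen (snd p) s \<otimes>\<^bsub>G\<^esub> x_gen (fst p) r \<otimes>\<^bsub>G\<^esub> x_gen (snd p) s =
      z_gen p (r \<otimes> s)"
    using assms J_D(1,2)[OF assms(1)]
    by (simp add: gen_word_comm GG.eval_word_gen[OF gen_closed])
  then show ?thesis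
    using assms J_D(1,2)[OF assms(1)]
    by (subst (asm) GG.commutator_eq_iff) (simp_all add: x_gen_closed z_gen_closed)
qed

lemma gen_commute:
  assumes "(word_comm (word_gen s) (word_gen t), []) \<in> rels" "s \<in> gens" "t \<in> gens"
  shows "gen s \<otimes>\<^bsub>G\<^esub> gen t = gen t \<otimes>\<^bsub>G\<^esub> gen s"
  using gen_rel[OF assms(1)] assms(2,3) funcset_mem[OF gen_closed]
  by (simp add: gen_word_comm GG.commutator_eq_iff)

lemma x_gen_commute:
  assumes "i \<in> {1..n}" "j \<in> {1..n}" "{v i, v j} \<notin> E" "r \<in> carrier F" "s \<in> carrier F"
  shows "x_gen i r \<otimes>\<^bsub>G\<^esub> x_gen j s = x_gen j s \<otimes>\<^bsub>G\<^esub> x_gen i r"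
proof (rule gen_commute)
  show "(word_comm (word_gen (XGen i r)) (word_gen (XGen j s)), []) \<in> rels"
    unfolding graphical_rels_iff
    by (rule disjI2, rule disjI2, rule disjI2, rule disjI1, rule bexI, rule bexI, rule bexI, rule bexI, rule conjI, rule assms, rule conjI, rule HOL.refl, rule HOL.refl) (rule assms)+
qed (use assms in auto)

lemma z_gen_commute:
  assumes "p \<in> J" "r \<in> carrier F" "t \<in> gens"
  shows "z_gen p r \<otimes>\<^bsub>G\<^esub> gen t = gen t \<otimes>\<^bsub>G\<^esub> z_gen p r"
proof (rule gen_commute[symmetric])
  show "(word_comm (word_gen t) (word_gen (ZGen (fst p) (snd p) r)), []) \<in> rels"
    unfolding graphical_rels_iff
    by (rule disjI2, rule disjI2, rule disjI2, rule disjI2, rule bexI, rule bexI, rule bexI, rule conjI, rule HOL.refl, rule HOL.refl) (rule assms)+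
qed (use assms in auto)

text \<open>Additivity makes this element idempotent, hence trivial.\<close>

lemma z_gen_zero: "p \<in> J \<Longrightarrow> z_gen p \<zero> = \<one>\<^bsub>G\<^esub>"
  using z_gen_add[of p \<zero> \<zero>] z_gen_closed[of p \<zero>] GG.l_cancel_one[of "z_gen p \<zero>" "z_gen p \<zero>"] by simp

lemma x_gen_zero: "i \<in> {1..n} \<Longrightarrow> x_gen i \<zero> = \<one>\<^bsub>G\<^esub>"
  using x_gen_add[of i \<zero> \<zero>] x_gen_closed[of i \<zero>] GG.l_cancel_one[of "x_gen i \<zero>" "x_gen i \<zero>"] by simp

lemma inv_z_gen:
  assumes "p \<in> J" "r \<in> carrier F"
  shows "inv\<^bsub>G\<^esub> z_gen p r = z_gen p (\<ominus> r)"
  using assms z_gen_add[of p "\<ominus> r" r] z_gen_zero z_gen_closed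
  by (intro GG.inv_equality) (simp_all add: l_neg)

lemma inv_x_gen:
  assumes "i \<in> {1..n}" "r \<in> carrier F"
  shows "inv\<^bsub>G\<^esub> x_gen i r = x_gen i (\<ominus> r)"
  using assms x_gen_add[of i "\<ominus> r" r] x_gen_zero x_gen_closed
  by (intro GG.inv_equality) (simp_all add: l_neg)

text \<open>Central, but possibly smaller than the centre: the \<open>x_gen\<close> of an isolated
  vertex are central as well.\<close>

definition center_part :: "'r graphical_gen word set set" where
  "center_part = generate G {z_gen p r | p r. p \<in> J \<and> r \<in> carrier F}"

lemma z_gens_subset: "{z_gen p r | p r. p \<in> J \<and> r \<in> carrier F} \<subseteq> carrier G"
  using z_gen_closed by auto

lemma subgroup_center_part: "subgroup center_part G"
  unfolding center_part_def by (rule GG.generate_is_subgroup[OF z_gens_subset])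

lemma z_gen_in_center_part: "p \<in> J \<Longrightarrow> r \<in> carrier F \<Longrightarrow> z_gen p r \<in> center_part"
  unfolding center_part_def by (rule generate.incl) blast

lemma center_part_central:
  assumes "c \<in> center_part" "x \<in> carrier G"
  shows "c \<otimes>\<^bsub>G\<^esub> x = x \<otimes>\<^bsub>G\<^esub> c"
proof (rule GG.generate_commute[OF z_gens_subset])
  show "gen ` gens \<subseteq> carrier G" using gen_closed by auto
  show "c \<in> generate G {z_gen p r | p r. p \<in> J \<and> r \<in> carrier F}"
    using assms(1) by (simp add: center_part_def)
  show "x \<in> generate G (gen ` gens)" using assms(2) by (simp add: generate_gen)
qed (use z_gen_commute in auto)

text \<open>\<open>foldl\<close> nests to the left, so appending an index multiplies on the right;
  this is why the inductions over the list use \<open>rev_induct\<close>.\<close>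

definition x_prod :: "nat list \<Rightarrow> (nat \<Rightarrow> 'r) \<Rightarrow> 'r graphical_gen word set" where
  "x_prod is a = foldl (\<lambda>x i. x \<otimes>\<^bsub>G\<^esub> x_gen i (a i)) \<one>\<^bsub>G\<^esub> is"

definition z_prod :: "(nat \<times> nat) list \<Rightarrow> (nat \<times> nat \<Rightarrow> 'r) \<Rightarrow> 'r graphical_gen word set" where
  "z_prod js c = foldl (\<lambda>x p. x \<otimes>\<^bsub>G\<^esub> z_gen p (c p)) \<one>\<^bsub>G\<^esub> js"

lemma x_prod_closed:
  "set is \<subseteq> {1..n} \<Longrightarrow> a \<in> {1..n} \<rightarrow> carrier F \<Longrightarrow> x_prod is a \<in> carrier G"
  unfolding x_prod_def
  by (induction "is" rule: rev_induct) (simp_all add: x_gen_closed Pi_iff)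

lemma z_prod_closed:
  "set js \<subseteq> J \<Longrightarrow> c \<in> J \<rightarrow> carrier F \<Longrightarrow> z_prod js c \<in> carrier G"
  unfolding z_prod_def
  by (induction js rule: rev_induct) (simp_all add: z_gen_closed Pi_iff)

lemma z_prod_zero: "set js \<subseteq> J \<Longrightarrow> z_prod js (\<lambda>_. \<zero>) = \<one>\<^bsub>G\<^esub>"
  unfolding z_prod_def by (induction js rule: rev_induct) (simp_all add: z_gen_zero)

lemma x_prod_zero: "set is \<subseteq> {1..n} \<Longrightarrow> x_prod is (\<lambda>_. \<zero>) = \<one>\<^bsub>G\<^esub>"
  unfolding x_prod_def
  by (induction "is" rule: rev_induct) (simp_all add: x_gen_zero)

text \<open>The central generators commute exactly, so collecting them leaves nothing over: the
  collecting lemma is used with the trivial subgroup as its set of corrections.\<close>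

lemma center_part_subset_z_prod:
  assumes "set js = J" "distinct js"
  shows "center_part \<subseteq> z_prod js ` (J \<rightarrow> carrier F)"
  unfolding center_part_def
proof (rule GG.generate_subset_absorbing[OF _ z_gens_subset])
  show "z_prod js ` (J \<rightarrow> carrier F) \<subseteq> carrier G"
    using z_prod_closed assms by auto
  have "(\<lambda>_. \<zero>) \<in> J \<rightarrow> carrier F" by auto
  then show "\<one>\<^bsub>G\<^esub> \<in> z_prod js ` (J \<rightarrow> carrier F)"
    using z_prod_zero[of js] assms by (metis image_eqI order_refl)
next
  fix x h assume "x \<in> z_prod js ` (J \<rightarrow> carrier F)" "h \<in> {z_gen p r | p r. p \<in> J \<and> r \<in> carrier F}"
  then obtain c p r where x: "x = z_prod js c" "h = z_gen p r"
    and *: "c \<in> J \<rightarrow> carrier F" "p \<in> J" "r \<in> carrier F" by auto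
  have "\<exists>d\<in>{\<one>\<^bsub>G\<^esub>}. foldl (\<lambda>x p. x \<otimes>\<^bsub>G\<^esub> z_gen p (c p)) \<one>\<^bsub>G\<^esub> js \<otimes>\<^bsub>G\<^esub> z_gen p r =
      foldl (\<lambda>x q. x \<otimes>\<^bsub>G\<^esub> z_gen q ((c(p := c p \<oplus> r)) q)) \<one>\<^bsub>G\<^esub> js \<otimes>\<^bsub>G\<^esub> d"
  proof (rule GG.collect_into_ordered_product[where I = J and K = "carrier F" and oplus = "\<lambda>r s. r \<oplus> s"])
    show "subgroup {\<one>\<^bsub>G\<^esub>} G" by (rule GG.triv_subgroup)
    fix p q r s assume *: "p \<in> J" "q \<in> J" "r \<in> carrier F" "s \<in> carrier F"
    have "z_gen p r \<otimes>\<^bsub>G\<^esub> z_gen q s = z_gen q s \<otimes>\<^bsub>G\<^esub> z_gen p r"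
      using * by (intro z_gen_commute) auto
    then show "\<exists>c\<in>{\<one>\<^bsub>G\<^esub>}. z_gen p r \<otimes>\<^bsub>G\<^esub> z_gen q s = z_gen q s \<otimes>\<^bsub>G\<^esub> z_gen p r \<otimes>\<^bsub>G\<^esub> c"
      using * z_gen_closed by simp
  qed (use assms * z_gen_closed z_gen_add in auto)
  moreover have c': "c(p := c p \<oplus> r) \<in> J \<rightarrow> carrier F" using * by (auto simp: Pi_iff)
  ultimately have "x \<otimes>\<^bsub>G\<^esub> h = z_prod js (c(p := c p \<oplus> r))"
    using z_prod_closed[OF _ c', of js] assms unfolding z_prod_def x by simp
  then show "x \<otimes>\<^bsub>G\<^esub> h \<in> z_prod js ` (J \<rightarrow> carrier F)" using c' by blast
next
  fix h assume "h \<in> {z_gen p r | p r. p \<in> J \<and> r \<in> carrier F}"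
  then show "inv\<^bsub>G\<^esub> h \<in> {z_gen p r | p r. p \<in> J \<and> r \<in> carrier F}"
    using inv_z_gen by (smt (verit) a_inv_closed mem_Collect_eq)
qed

lemma x_gen_swap:
  assumes "i \<in> {1..n}" "j \<in> {1..n}" "i \<noteq> j" "r \<in> carrier F" "s \<in> carrier F"
  shows "\<exists>c\<in>center_part. x_gen i r \<otimes>\<^bsub>G\<^esub> x_gen j s = x_gen j s \<otimes>\<^bsub>G\<^esub> x_gen i r \<otimes>\<^bsub>G\<^esub> c"
proof -
  consider "(i, j) \<in> J" | "(j, i) \<in> J" | "{v i, v j} \<notin> E"
    using assms(1-3) by (cases i j rule: linorder_cases) (auto simp: edge_indices_def insert_commute)
  then show ?thesis
  proof cases
    case 1
    then show ?thesis
      using x_gen_commutator[OF 1, of r s] z_gen_in_center_part[OF 1] assms by auto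
  next
    case 2
    \<comment> \<open>The defining relation is oriented from \<open>j\<close> to \<open>i\<close>;
      swapping in the opposite direction costs the inverse of this element.\<close>
    let ?z = "z_gen (j, i) (s \<otimes> r)"
    have z: "?z \<in> center_part" "?z \<in> carrier G"
      using z_gen_in_center_part[OF 2] z_gen_closed[OF 2] assms by auto
    have "x_gen j s \<otimes>\<^bsub>G\<^esub> x_gen i r \<otimes>\<^bsub>G\<^esub> inv\<^bsub>G\<^esub> ?z = x_gen i r \<otimes>\<^bsub>G\<^esub> x_gen j s"
      using x_gen_commutator[OF 2, of s r] z x_gen_closed assms by (simp add: GG.m_assoc)
    then show ?thesis
      using subgroup.m_inv_closed[OF subgroup_center_part z(1)] by metis
  next
    case 3
    then show ?thesis
      using x_gen_commute[OF assms(1,2) 3] assms subgroup.one_closed[OF subgroup_center_part]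
        x_gen_closed by (intro bexI[of _ "\<one>\<^bsub>G\<^esub>"]) simp_all
  qed
qed

lemma carrier_normal_form:
  assumes "x \<in> carrier G" and js: "set js = J" "distinct js"
  shows "\<exists>a\<in>{1..n} \<rightarrow>\<^sub>E carrier F. \<exists>c\<in>J \<rightarrow>\<^sub>E carrier F. x = x_prod [1..<Suc n] a \<otimes>\<^bsub>G\<^esub> z_prod js c"
proof -
  let ?is = "[1..<Suc n]"
  have set_is: "set ?is = {1..n}" by auto
  \<comment> \<open>The central factor stays uncollected here. Corrections from swaps and new
    central generators are multiplied into it, which makes the set absorb every generator.\<close>
  let ?A = "{x_prod ?is a \<otimes>\<^bsub>G\<^esub> z | a z. a \<in> {1..n} \<rightarrow> carrier F \<and> z \<in> center_part}"
  have cp: "z \<in> carrier G" if "z \<in> center_part" for z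
    using that subgroup.subset[OF subgroup_center_part] by auto
  have cl: "x_prod ?is a \<in> carrier G" if "a \<in> {1..n} \<rightarrow> carrier F" for a
    using x_prod_closed[OF _ that] set_is by simp
  have "generate G (gen ` gens) \<subseteq> ?A"
  proof (rule GG.generate_subset_absorbing)
    show "?A \<subseteq> carrier G" using cp cl by auto
    show "gen ` gens \<subseteq> carrier G" using gen_closed by auto
    have "\<one>\<^bsub>G\<^esub> = x_prod ?is (\<lambda>_. \<zero>) \<otimes>\<^bsub>G\<^esub> \<one>\<^bsub>G\<^esub>"
      using x_prod_zero[of ?is] set_is by simp
    then show "\<one>\<^bsub>G\<^esub> \<in> ?A"
      using subgroup.one_closed[OF subgroup_center_part] by fastforce
  next
    fix x h assume "x \<in> ?A" "h \<in> gen ` gens"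
    then obtain a z t where x: "x = x_prod ?is a \<otimes>\<^bsub>G\<^esub> z" "h = gen t"
      and *: "a \<in> {1..n} \<rightarrow> carrier F" "z \<in> center_part" "t \<in> gens" by auto
    show "x \<otimes>\<^bsub>G\<^esub> h \<in> ?A"
    proof (cases t)
      case (XGen i r)
      then have ir: "i \<in> {1..n}" "r \<in> carrier F" using * by auto
      have "\<exists>c\<in>center_part. foldl (\<lambda>x i. x \<otimes>\<^bsub>G\<^esub> x_gen i (a i)) \<one>\<^bsub>G\<^esub> ?is \<otimes>\<^bsub>G\<^esub> x_gen i r =
        foldl (\<lambda>x j. x \<otimes>\<^bsub>G\<^esub> x_gen j ((a(i := a i \<oplus> r)) j)) \<one>\<^bsub>G\<^esub> ?is \<otimes>\<^bsub>G\<^esub> c"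
        by (rule GG.collect_into_ordered_product[where I = "{1..n}" and K = "carrier F" and
              oplus = "\<lambda>r s. r \<oplus> s", OF subgroup_center_part center_part_central])
          (use ir set_is *(1) x_gen_closed x_gen_add x_gen_swap in auto)
      then obtain c where c: "c \<in> center_part"
        "x_prod ?is a \<otimes>\<^bsub>G\<^esub> x_gen i r = x_prod ?is (a(i := a i \<oplus> r)) \<otimes>\<^bsub>G\<^esub> c"
        unfolding x_prod_def by blast
      have a': "a(i := a i \<oplus> r) \<in> {1..n} \<rightarrow> carrier F" using * ir by (auto simp: Pi_iff)
      have "x \<otimes>\<^bsub>G\<^esub> h = x_prod ?is a \<otimes>\<^bsub>G\<^esub> x_gen i r \<otimes>\<^bsub>G\<^esub> z"
        using center_part_central[OF *(2) x_gen_closed[OF ir]] cl[OF *(1)] cp[OF *(2)] x_gen_closed[OF ir]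
        by (simp add: x XGen GG.m_assoc)
      also have "\<dots> = x_prod ?is (a(i := a i \<oplus> r)) \<otimes>\<^bsub>G\<^esub> (c \<otimes>\<^bsub>G\<^esub> z)"
        unfolding c using cl[OF a'] cp[OF *(2)] cp[OF c(1)] by (simp add: GG.m_assoc)
      finally show ?thesis
        using a' subgroup.m_closed[OF subgroup_center_part c(1) *(2)] by blast
    next
      case (ZGen j k r)
      then have h: "h \<in> center_part" using z_gen_in_center_part[of "(j, k)" r] * x by simp
      have "x \<otimes>\<^bsub>G\<^esub> h = x_prod ?is a \<otimes>\<^bsub>G\<^esub> (z \<otimes>\<^bsub>G\<^esub> h)"
        using cl[OF *(1)] cp[OF *(2)] cp[OF h] by (simp add: x(1) GG.m_assoc)
      then show ?thesis
        using *(1) subgroup.m_closed[OF subgroup_center_part *(2) h] by blast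
    qed
  next
    fix h assume "h \<in> gen ` gens"
    then obtain t where t: "h = gen t" "t \<in> gens" by auto
    show "inv\<^bsub>G\<^esub> h \<in> gen ` gens"
    proof (cases t)
      case (XGen i r)
      then show ?thesis using t inv_x_gen[of i r] by (intro image_eqI[of _ _ "XGen i (\<ominus> r)"]) auto
    next
      case (ZGen j k r)
      then show ?thesis using t inv_z_gen[of "(j, k)" r] by (intro image_eqI[of _ _ "ZGen j k (\<ominus> r)"]) auto
    qed
  qed
  then obtain a z where x: "x = x_prod ?is a \<otimes>\<^bsub>G\<^esub> z" and a: "a \<in> {1..n} \<rightarrow> carrier F" and z: "z \<in> center_part"
    using assms(1) generate_gen by auto
  obtain c where c: "z = z_prod js c" "c \<in> J \<rightarrow> carrier F"
    using center_part_subset_z_prod[OF js] z by auto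
  \<comment> \<open>Changing parameters off the index sets leaves the products unchanged, and
    extensional parameters form a finite set whose size will bound the order.\<close>
  have "x_prod ?is a = x_prod ?is (restrict a {1..n})"
    unfolding x_prod_def by (rule foldl_cong) auto
  moreover have "z_prod js c = z_prod js (restrict c J)"
    unfolding z_prod_def by (rule foldl_cong) (auto simp: js)
  moreover have "restrict a {1..n} \<in> {1..n} \<rightarrow>\<^sub>E carrier F" "restrict c J \<in> J \<rightarrow>\<^sub>E carrier F"
    using a c by auto
  ultimately show ?thesis using x c(1) by metis
qed

section \<open>Isomorphism with the model\<close>

definition gen_model :: "'r graphical_gen \<Rightarrow> ('v \<Rightarrow> 'r) \<times> (nat \<times> nat \<Rightarrow> 'r)" where
  "gen_model t = (case t of XGen i r \<Rightarrow> x_model i r | ZGen j k r \<Rightarrow> z_model j k r)"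

lemma gen_model_simps [simp]:
  "gen_model (XGen i r) = x_model i r"
  "gen_model (ZGen j k r) = z_model j k r"
  by (simp_all add: gen_model_def)

lemma gen_model_closed: "gen_model \<in> gens \<rightarrow> carrier model"
proof
  fix t assume "t \<in> gens"
  then show "gen_model t \<in> carrier model"
    by (cases t) (simp_all add: x_model_closed z_model_closed)
qed

lemma gen_model_word_comm:
  assumes "s \<in> gens" "t \<in> gens" "z \<in> carrier model"
    and "gen_model s \<otimes>\<^bsub>model\<^esub> gen_model t = gen_model t \<otimes>\<^bsub>model\<^esub> gen_model s \<otimes>\<^bsub>model\<^esub> z"
  shows "eval_word model gen_model (word_comm (word_gen s) (word_gen t)) = z"
proof -
  have "gen_model s \<in> carrier model" "gen_model t \<in> carrier model"
    using assms(1,2) funcset_mem[OF gen_model_closed] by auto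
  then show ?thesis
    using assms M.commutator_eq_iff
    by (simp add: M.eval_word_comm[OF gen_model_closed] M.eval_word_gen[OF gen_model_closed])
qed

lemma gen_model_rel:
  assumes "(l, w) \<in> rels"
  shows "eval_word model gen_model l = eval_word model gen_model w"
proof -
  note ev = M.eval_word_append[OF gen_model_closed] M.eval_word_gen[OF gen_model_closed]
  show ?thesis
    using assms unfolding graphical_rels_iff
  proof (elim disjE bexE conjE)
    fix i r s
    assume "i \<in> {1..n}" "r \<in> carrier F" "s \<in> carrier F"
      "l = word_gen (XGen i r) @ word_gen (XGen i s)" "w = word_gen (XGen i (r \<oplus> s))"
    then show ?thesis by (simp add: ev x_model_add)
  next
    fix p r s
    assume "p \<in> J" "r \<in> carrier F" "s \<in> carrier F"
      "l = word_gen (ZGen (fst p) (snd p) r) @ word_gen (ZGen (fst p) (snd p) s)"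
      "w = word_gen (ZGen (fst p) (snd p) (r \<oplus> s))"
    then show ?thesis by (simp add: ev z_model_add)
  next
    fix p r s
    assume *: "p \<in> J" "r \<in> carrier F" "s \<in> carrier F"
      "l = word_comm (word_gen (XGen (fst p) r)) (word_gen (XGen (snd p) s))"
      "w = word_gen (ZGen (fst p) (snd p) (r \<otimes> s))"
    have "eval_word model gen_model l = z_model (fst p) (snd p) (r \<otimes> s)"
      unfolding *(4) using * J_D(1,2)[OF *(1)] x_model_commutator[of r s "fst p" "snd p"]
      by (intro gen_model_word_comm) (simp_all add: z_model_closed)
    then show ?thesis using * by (simp add: ev)
  next
    fix i j r s
    assume *: "i \<in> {1..n}" "j \<in> {1..n}" "r \<in> carrier F" "s \<in> carrier F" "{v i, v j} \<notin> E"
      "l = word_comm (word_gen (XGen i r)) (word_gen (XGen j s))" "w = []"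
    have "eval_word model gen_model l = \<one>\<^bsub>model\<^esub>"
      unfolding *(6) using * x_model_commute[OF *(3,4,1,2,5)]
      by (intro gen_model_word_comm) (simp_all add: x_model_closed)
    then show ?thesis using * by simp
  next
    fix t p r
    assume *: "t \<in> gens" "p \<in> J" "r \<in> carrier F"
      "l = word_comm (word_gen t) (word_gen (ZGen (fst p) (snd p) r))" "w = []"
    then have t: "gen_model t \<in> carrier model" using funcset_mem[OF gen_model_closed] by simp
    have "eval_word model gen_model l = \<one>\<^bsub>model\<^esub>"
      unfolding *(4) using * t z_model_central[OF *(3) t, of "fst p" "snd p"]
      by (intro gen_model_word_comm) (simp_all add: z_model_closed)
    then show ?thesis using * by simp
  qed
qed

lemma fst_model_mult: "u \<in> V \<Longrightarrow> fst (x \<otimes>\<^bsub>model\<^esub> y) u = fst x u \<oplus> fst y u"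
  by (cases x; cases y) (simp add: model_simps)

lemma card_model: "card (carrier model) = card (carrier F) ^ (n + card J)"
proof -
  have "card V = n" using bij_betw_same_card[OF enum] by simp
  then show ?thesis
    by (simp add: model_simps card_cartesian_product card_PiE finite_V finite_J power_add)
qed

lemma finite_model: "finite (carrier model)"
  using finite_V finite_J finite_carrier by (simp add: model_simps finite_PiE)

lemma card_graphical_group_le: "finite (carrier G)" "card (carrier G) \<le> card (carrier F) ^ (n + card J)"
proof -
  obtain js where js: "set js = J" "distinct js" using finite_distinct_list[OF finite_J] by blast
  let ?D = "({1..n} \<rightarrow>\<^sub>E carrier F) \<times> (J \<rightarrow>\<^sub>E carrier F)"
  let ?f = "\<lambda>(a, c). x_prod [1..<Suc n] a \<otimes>\<^bsub>G\<^esub> z_prod js c"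
  have D: "finite ?D" using finite_J finite_carrier by (simp add: finite_PiE)
  have sub: "carrier G \<subseteq> ?f ` ?D"
  proof
    fix x assume "x \<in> carrier G"
    from carrier_normal_form[OF this js] show "x \<in> ?f ` ?D" by force
  qed
  then show "finite (carrier G)" using D finite_surj by blast
  have "card (carrier G) \<le> card ?D" using surj_card_le[OF D sub] .
  also have "card ?D = card (carrier F) ^ (n + card J)"
    by (simp add: card_cartesian_product card_PiE finite_J power_add)
  finally show "card (carrier G) \<le> card (carrier F) ^ (n + card J)" .
qed

lemma graphical_group_iso_model: "\<exists>\<psi>. \<psi> \<in> iso G model"
proof -
  obtain \<psi> where hom: "\<psi> \<in> hom G model"
    and \<psi>: "\<And>w. w \<in> words_on gens \<Longrightarrow> \<psi> (word_rel gens rels `` {w}) = eval_word model gen_model w"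
    using M.presented_group_lift[OF gen_model_closed rels_in_words gen_model_rel]
    unfolding graphical_group_def by blast
  interpret group_hom G model \<psi>
    using hom by unfold_locales
  have \<psi>_gen: "\<psi> (gen t) = gen_model t" if "t \<in> gens" for t
    using \<psi>[of "word_gen t"] that by (simp add: gen_def M.eval_word_gen[OF gen_model_closed])
  \<comment> \<open>Only the first coordinate is tracked, since it is additive. The second one
    accumulates cocycle terms and is corrected afterwards by a central factor.\<close>
  have x_prod: "fst (\<psi> (x_prod is a)) (v i) = (if i \<in> set is then a i else \<zero>)"
    if "set is \<subseteq> {1..n}" "distinct is" "a \<in> {1..n} \<rightarrow> carrier F" "i \<in> {1..n}" for "is" a i
    using that(1,2)
  proof (induction "is" rule: rev_induct)
    case Nil
    then show ?case using v_in_V[OF that(4)] by (simp add: x_prod_def model_simps)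
  next
    case (snoc j js)
    have j: "j \<in> {1..n}" "a j \<in> carrier F" using snoc.prems that(3) by auto
    have "\<psi> (x_prod (js @ [j]) a) = \<psi> (x_prod js a) \<otimes>\<^bsub>model\<^esub> x_model j (a j)"
      using x_prod_closed[of js a] x_gen_closed[OF j] \<psi>_gen[of "XGen j (a j)"] snoc.prems j that(3)
      by (simp add: x_prod_def)
    then have "fst (\<psi> (x_prod (js @ [j]) a)) (v i) =
        (if i \<in> set js then a i else \<zero>) \<oplus> fst (x_model j (a j)) (v i)"
      using v_in_V[OF that(4)] snoc by (simp add: fst_model_mult)
    then show ?case
      using v_in_V[OF that(4)] v_eq_iff[OF that(4) j(1)] snoc.prems j(2) that(3,4)
      by (auto simp: x_model_def Pi_iff)
  qed
  have z_prod: "\<psi> (z_prod js c) = (\<lambda>u\<in>V. \<zero>, \<lambda>p\<in>J. if p \<in> set js then c p else \<zero>)"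
    if "set js \<subseteq> J" "distinct js" "c \<in> J \<rightarrow> carrier F" for js c
    using that(1,2)
  proof (induction js rule: rev_induct)
    case Nil
    then show ?case by (simp add: z_prod_def model_simps restrict_def)
  next
    case (snoc p js)
    have p: "p \<in> J" "c p \<in> carrier F" using snoc.prems that(3) by auto
    have "\<psi> (z_prod (js @ [p]) c) = \<psi> (z_prod js c) \<otimes>\<^bsub>model\<^esub> z_model (fst p) (snd p) (c p)"
      using z_prod_closed[of js c] z_gen_closed[OF p] \<psi>_gen[of "ZGen (fst p) (snd p) (c p)"] snoc.prems p that(3)
      by (simp add: z_prod_def)
    also have "\<dots> = (\<lambda>u\<in>V. \<zero>, \<lambda>p\<in>J. if p \<in> set js then c p else \<zero>) \<otimes>\<^bsub>model\<^esub> z_model (fst p) (snd p) (c p)"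
      by (subst snoc.IH) (use snoc.prems in auto)
    also have "\<dots> = (\<lambda>u\<in>V. \<zero>, \<lambda>q\<in>J. if q \<in> set (js @ [p]) then c q else \<zero>)"
    proof -
      have "(if q \<in> set js then c q else \<zero>) \<oplus> (if q = p then c p else \<zero>) =
          (if q = p \<or> q \<in> set js then c q else \<zero>)" if "q \<in> J" for q
        using that snoc.prems p(2) funcset_mem[OF \<open>c \<in> J \<rightarrow> carrier F\<close> that] by auto
      then show ?thesis
        using J_D(4,5) p(2) funcset_mem[OF that(3)]
        by (simp add: z_model_def model_simps cong: restrict_cong)
    qed
    finally show ?case .
  qed
  obtain js where js: "set js = J" "distinct js" using finite_distinct_list[OF finite_J] by blast
  have "carrier model \<subseteq> \<psi> ` carrier G"
  proof
    fix y assume "y \<in> carrier model"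
    then obtain a c where y: "y = (a, c)" and a: "a \<in> V \<rightarrow>\<^sub>E carrier F" and c: "c \<in> J \<rightarrow>\<^sub>E carrier F"
      by (auto simp: model_simps)
    define x where "x = x_prod [1..<Suc n] (\<lambda>i. a (v i))"
    have av: "(\<lambda>i. a (v i)) \<in> {1..n} \<rightarrow> carrier F"
      using PiE_mem[OF a v_in_V] by (intro funcsetI) auto
    have x: "x \<in> carrier G"
      unfolding x_def by (rule x_prod_closed[OF _ av]) auto
    obtain b d where bd: "\<psi> x = (b, d)" by (cases "\<psi> x")
    then have b: "b \<in> V \<rightarrow>\<^sub>E carrier F" and d: "d \<in> J \<rightarrow>\<^sub>E carrier F"
      using hom_closed[OF x] by (simp_all add: model_simps)
    have set_is: "set [1..<Suc n] = {1..n}" by auto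
    have "b = a"
    proof (rule PiE_ext[OF b a])
      fix u assume "u \<in> V"
      then obtain i where i: "i \<in> {1..n}" "u = v i" using enum by (auto simp: bij_betw_def)
      then show "b u = a u"
        using x_prod[OF _ distinct_upt av i(1), of 1 "Suc n"] bd
        unfolding x_def set_is by (simp only: i order_refl if_True fst_conv)
    qed
    \<comment> \<open>\<open>d\<close> is whatever the ordered product produced in the second
      coordinate; a central factor with values \<open>e\<close> shifts it to
      \<open>c\<close>.\<close>
    define e where "e = (\<lambda>p. \<ominus> d p \<oplus> c p)"
    have e: "e \<in> J \<rightarrow> carrier F"
      using PiE_mem[OF c] PiE_mem[OF d] by (auto simp: e_def)
    have z: "z_prod js e \<in> carrier G" using z_prod_closed[OF _ e] js by simp
    have "d p \<oplus> e p = c p" if "p \<in> J" for p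
      using PiE_mem[OF c that] PiE_mem[OF d that] by (simp add: e_def a_assoc[symmetric] r_neg)
    then have "(a, d) \<otimes>\<^bsub>model\<^esub> (\<lambda>u\<in>V. \<zero>, \<lambda>p\<in>J. e p) = (a, c)"
      using PiE_mem[OF a] PiE_mem[OF c] J_D(4,5) a c
      by (auto simp: model_simps intro!: PiE_ext[OF _ a] PiE_ext[OF _ c])
    then have "\<psi> (x \<otimes>\<^bsub>G\<^esub> z_prod js e) = y"
      using x z z_prod[OF _ js(2) e] bd \<open>b = a\<close> by (simp add: y js cong: restrict_cong)
    then show "y \<in> \<psi> ` carrier G" using x z by (metis GG.m_closed image_eqI)
  qed
  then have surj: "\<psi> ` carrier G = carrier model" using hom_closed by blast
  have "card (carrier model) \<le> card (carrier G)"
    unfolding surj[symmetric] by (rule card_image_le[OF card_graphical_group_le(1)])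
  then have "card (\<psi> ` carrier G) = card (carrier G)"
    using card_graphical_group_le(2) card_model surj by simp
  then have "inj_on \<psi> (carrier G)"
    by (rule eq_card_imp_inj_on[OF card_graphical_group_le(1)])
  then have "\<psi> \<in> iso G model"
    unfolding iso_def bij_betw_def using hom surj by blast
  then show ?thesis by blast
qed

end

section \<open>Centralisers and class sizes\<close>

context graphical
begin

lemma edge_in_V:
  assumes "{u, w} \<in> E"
  shows "u \<in> V" "w \<in> V" "u \<noteq> w"
proof -
  obtain x y where "{u, w} = {x, y}" "x \<in> V" "y \<in> V" "x \<noteq> y"
    using assms graph unfolding finite_simple_graph_def by blast
  then show "u \<in> V" "w \<in> V" "u \<noteq> w" by (auto simp: doubleton_eq_iff)
qed

text \<open>An edge carries no orientation, while \<open>J\<close> lists it with the smaller index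
  first, so either endpoint may be the first component.\<close>

lemma edge_index:
  assumes "{u, w} \<in> E"
  obtains p where "p \<in> J" "u = v (fst p)" "w = v (snd p)"
    | p where "p \<in> J" "w = v (fst p)" "u = v (snd p)"
proof -
  obtain i j where ij: "i \<in> {1..n}" "j \<in> {1..n}" "u = v i" "w = v j"
    using edge_in_V[OF assms] enum by (auto simp: bij_betw_def)
  then have "i \<noteq> j" using edge_in_V(3)[OF assms] by auto
  then consider "i < j" | "j < i" by linarith
  then show thesis
  proof cases
    case 1
    then have "(i, j) \<in> J" using ij assms by (auto simp: edge_indices_def)
    then show thesis using that(1)[of "(i, j)"] ij by simp
  next
    case 2
    then have "(j, i) \<in> J" using ij assms by (auto simp: edge_indices_def insert_commute)
    then show thesis using that(2)[of "(j, i)"] ij by simp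
  qed
qed

lemma card_J: "card J = card E"
proof -
  have "bij_betw (\<lambda>p. {v (fst p), v (snd p)}) J E"
    unfolding bij_betw_def
  proof (intro conjI inj_onI equalityI subsetI)
    fix p p' assume p: "p \<in> J" "p' \<in> J" and eq: "{v (fst p), v (snd p)} = {v (fst p'), v (snd p')}"
    note d = J_D[OF p(1)] J_D[OF p(2)]
    from eq consider "v (fst p) = v (fst p')" "v (snd p) = v (snd p')"
      | "v (fst p) = v (snd p')" "v (snd p) = v (fst p')"
      by (auto simp: doubleton_eq_iff)
    then show "p = p'"
    proof cases
      case 1
      then show ?thesis using d v_eq_iff by (simp add: prod_eq_iff)
    next
      case 2
      then have "fst p = snd p'" "snd p = fst p'" using d v_eq_iff by simp_all
      then show ?thesis using d by linarith
    qed
  next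
    fix e assume "e \<in> (\<lambda>p. {v (fst p), v (snd p)}) ` J"
    then show "e \<in> E" using J_D(6) by auto
  next
    fix e assume e: "e \<in> E"
    then obtain u w where uw: "e = {u, w}"
      using graph unfolding finite_simple_graph_def by blast
    from e[unfolded uw] show "e \<in> (\<lambda>p. {v (fst p), v (snd p)}) ` J"
      by (cases rule: edge_index) (auto simp: uw insert_commute)
  qed
  then show ?thesis by (rule bij_betw_same_card)
qed

text \<open>The projection to first coordinates of the centraliser of any \<open>(a, c)\<close>;
  second coordinates are unconstrained. The condition is the vanishing of a 2 x 2 minor at each
  edge, symmetric in \<open>u\<close> and \<open>w\<close>, so the orientation of edges
  disappears.\<close>

definition centralizer :: "('v \<Rightarrow> 'r) \<Rightarrow> ('v \<Rightarrow> 'r) set" where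
  "centralizer a =
     {b \<in> V \<rightarrow>\<^sub>E carrier F. \<forall>u w. {u, w} \<in> E \<longrightarrow> a u \<otimes> b w = a w \<otimes> b u}"

definition support :: "('v \<Rightarrow> 'r) \<Rightarrow> 'v set" where
  "support a = {u \<in> V. a u \<noteq> \<zero>}"

lemma model_commute_iff:
  assumes a: "a \<in> V \<rightarrow>\<^sub>E carrier F" and c: "c \<in> J \<rightarrow>\<^sub>E carrier F"
    and b: "b \<in> V \<rightarrow>\<^sub>E carrier F" and d: "d \<in> J \<rightarrow>\<^sub>E carrier F"
  shows "(b, d) \<otimes>\<^bsub>model\<^esub> (a, c) = (a, c) \<otimes>\<^bsub>model\<^esub> (b, d) \<longleftrightarrow> b \<in> centralizer a"
proof -
  have V: "a u \<in> carrier F" "b u \<in> carrier F" if "u \<in> V" for u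
    using PiE_mem[OF a that] PiE_mem[OF b that] .
  have Jc: "c p \<in> carrier F" "d p \<in> carrier F" if "p \<in> J" for p
    using PiE_mem[OF c that] PiE_mem[OF d that] .
  \<comment> \<open>The first coordinates of the two products always agree, so commutation is
    decided in the second.\<close>
  have "(\<lambda>u\<in>V. b u \<oplus> a u) = (\<lambda>u\<in>V. a u \<oplus> b u)"
    using V by (intro restrict_ext) (simp add: a_comm)
  then have "(b, d) \<otimes>\<^bsub>model\<^esub> (a, c) = (a, c) \<otimes>\<^bsub>model\<^esub> (b, d) \<longleftrightarrow>
      (\<lambda>p\<in>J. d p \<oplus> c p \<oplus> b (v (fst p)) \<otimes> a (v (snd p))) =
      (\<lambda>p\<in>J. c p \<oplus> d p \<oplus> a (v (fst p)) \<otimes> b (v (snd p)))"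
    by (simp only: model_simps prod.inject simp_thms)
  also have "\<dots> \<longleftrightarrow> (\<forall>p\<in>J. d p \<oplus> c p \<oplus> b (v (fst p)) \<otimes> a (v (snd p)) =
      c p \<oplus> d p \<oplus> a (v (fst p)) \<otimes> b (v (snd p)))"
    by (auto simp: fun_eq_iff restrict_def)
  also have "\<dots> \<longleftrightarrow> (\<forall>p\<in>J. a (v (fst p)) \<otimes> b (v (snd p)) = a (v (snd p)) \<otimes> b (v (fst p)))"
  proof (rule ball_cong[OF HOL.refl])
    fix p assume p: "p \<in> J"
    note J_D(4,5)[OF p] Jc[OF p]
    moreover have "d p \<oplus> c p = c p \<oplus> d p" using Jc[OF p] by (simp add: a_comm)
    ultimately show "d p \<oplus> c p \<oplus> b (v (fst p)) \<otimes> a (v (snd p)) = c p \<oplus> d p \<oplus> a (v (fst p)) \<otimes> b (v (snd p)) \<longleftrightarrow>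
        a (v (fst p)) \<otimes> b (v (snd p)) = a (v (snd p)) \<otimes> b (v (fst p))"
      using V by (auto simp: m_comm)
  qed
  also have "\<dots> \<longleftrightarrow> (\<forall>u w. {u, w} \<in> E \<longrightarrow> a u \<otimes> b w = a w \<otimes> b u)"
  proof (intro iffI allI impI ballI)
    fix u w assume *: "\<forall>p\<in>J. a (v (fst p)) \<otimes> b (v (snd p)) = a (v (snd p)) \<otimes> b (v (fst p))"
      and "{u, w} \<in> E"
    from this(2) show "a u \<otimes> b w = a w \<otimes> b u"
      by (cases rule: edge_index) (use * in auto)
  qed (use J_D(6) in auto)
  finally show ?thesis using b by (simp add: centralizer_def)
qed

text \<open>Orbit-stabiliser, with the factor q^m from the free second coordinate of the stabiliser
  cancelled against the order q^(n + m).\<close>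

lemma card_conj_class_model:
  assumes "(a, c) \<in> carrier model"
  shows "card (conj_class model (a, c)) * card (centralizer a) = card (carrier F) ^ n"
proof -
  let ?\<phi> = "\<lambda>g. \<lambda>h\<in>carrier model. g \<otimes>\<^bsub>model\<^esub> h \<otimes>\<^bsub>model\<^esub> inv\<^bsub>model\<^esub> g"
  interpret A: group_action model "carrier model" ?\<phi> by (rule M.action_by_conjugation)
  have ac: "a \<in> V \<rightarrow>\<^sub>E carrier F" "c \<in> J \<rightarrow>\<^sub>E carrier F" using assms by (auto simp: model_simps)
  have fix_iff: "?\<phi> g (a, c) = (a, c) \<longleftrightarrow> g \<otimes>\<^bsub>model\<^esub> (a, c) = (a, c) \<otimes>\<^bsub>model\<^esub> g" if "g \<in> carrier model" for g
    using assms that M.inv_solve_right'[of "(a, c)" "g \<otimes>\<^bsub>model\<^esub> (a, c)" g] by simp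
  have "stabilizer model ?\<phi> (a, c) = centralizer a \<times> (J \<rightarrow>\<^sub>E carrier F)"
  proof (intro equalityI subsetI)
    fix g assume "g \<in> stabilizer model ?\<phi> (a, c)"
    then have g: "g \<in> carrier model" "?\<phi> g (a, c) = (a, c)"
      unfolding stabilizer_def by blast+
    obtain b d where bd: "g = (b, d)" by (cases g)
    then show "g \<in> centralizer a \<times> (J \<rightarrow>\<^sub>E carrier F)"
      using g fix_iff[OF g(1)] model_commute_iff[OF ac, of b d] by (simp add: model_simps(1))
  next
    fix g assume "g \<in> centralizer a \<times> (J \<rightarrow>\<^sub>E carrier F)"
    then obtain b d where bd: "g = (b, d)" "b \<in> centralizer a" "d \<in> J \<rightarrow>\<^sub>E carrier F" by auto
    then have b: "b \<in> V \<rightarrow>\<^sub>E carrier F" by (simp add: centralizer_def)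
    then have g: "g \<in> carrier model" using bd by (simp add: model_simps(1))
    then show "g \<in> stabilizer model ?\<phi> (a, c)"
      using fix_iff[OF g] model_commute_iff[OF ac b bd(3)] bd unfolding stabilizer_def by blast
  qed
  then have "card (stabilizer model ?\<phi> (a, c)) = card (centralizer a) * card (carrier F) ^ card J"
    by (simp add: card_cartesian_product card_PiE finite_J)
  moreover have "card (carrier F) \<noteq> 0" using finite_carrier zero_closed by auto
  ultimately show ?thesis
    using A.orbit_stabilizer_theorem[OF assms] orbit_conjugation[OF assms] card_model
    by (simp add: Coset.order_def power_add mult.assoc[symmetric])
qed

lemma field_inv:
  assumes "x \<in> carrier F" "x \<noteq> \<zero>"
  shows "inv x \<in> carrier F" "inv x \<otimes> x = \<one>" "x \<otimes> inv x = \<one>"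
  using assms field_Units by (auto simp: Units_l_inv Units_r_inv)

lemma card_centralizer:
  assumes a: "a \<in> V \<rightarrow>\<^sub>E carrier F"
  shows "card (centralizer a) = card (carrier F) ^
    (num_components E (support a) + (n - card (closed_nbhd V E (support a))))"
proof -
  define U where "U = support a"
  define N where "N = closed_nbhd V E U"
  define R where "R = {(u, w). {u, w} \<in> induced_edges E U}\<^sup>*"
  define C where "C = (\<lambda>u. R `` {u})"
  define comps where "comps = C ` U"
  have UV: "U \<subseteq> V" and NV: "N \<subseteq> V" and UN: "U \<subseteq> N"
    by (auto simp: U_def N_def support_def closed_nbhd_def)
  have aV: "a u \<in> carrier F" if "u \<in> V" for u using PiE_mem[OF a that] .
  have aU: "a u \<noteq> \<zero>" if "u \<in> U" for u using that by (simp add: U_def support_def)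
  have a0: "a u = \<zero>" if "u \<in> V" "u \<notin> U" for u using that by (simp add: U_def support_def)
  have comps: "connected_components U (induced_edges E U) = comps"
    by (auto simp: connected_components_def comps_def C_def R_def quotient_def)
  have sym_R: "sym R"
    unfolding R_def by (intro sym_rtrancl symI) (auto simp: insert_commute)
  have trans_R: "trans R" unfolding R_def by (rule trans_rtrancl)
  have C_eq: "C u = C w" if "(u, w) \<in> R" for u w
    using that sym_R trans_R unfolding C_def sym_def trans_def by blast
  have R_U: "w \<in> U" if "(u, w) \<in> R" "u \<in> U" for u w
    using that unfolding R_def by (induction rule: rtrancl_induct) (auto simp: induced_edges_def)
  have C_U: "C u \<subseteq> U" if "u \<in> U" for u using R_U that by (auto simp: C_def)
  \<comment> \<open>The scalar of a component has to be read off at some vertex; by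
    \<open>ratio\<close> below, the choice within the component does not matter.\<close>
  define rep where "rep = (\<lambda>X :: 'v set. SOME u. u \<in> X)"
  have rep: "rep (C u) \<in> C u" "C (rep (C u)) = C u" "(u, rep (C u)) \<in> R" for u
  proof -
    have "u \<in> C u" by (simp add: C_def R_def)
    then show *: "rep (C u) \<in> C u" unfolding rep_def by (rule someI)
    then show "(u, rep (C u)) \<in> R" by (simp add: C_def)
    then show "C (rep (C u)) = C u" by (rule C_eq[symmetric])
  qed
  \<comment> \<open>Coordinates on the centraliser: \<open>f\<close> holds one scalar per component
    and \<open>g\<close> the free values. \<open>\<Psi>\<close> recovers each scalar as a quotient
    at the representative.\<close>
  define \<Phi> where "\<Phi> = (\<lambda>(f, g). \<lambda>u\<in>V. if u \<in> U then a u \<otimes> f (C u) else if u \<in> N then \<zero> else g u)"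
  define \<Psi> where "\<Psi> = (\<lambda>b. (\<lambda>X\<in>comps. inv (a (rep X)) \<otimes> b (rep X), restrict b (V - N)))"
  let ?D = "(comps \<rightarrow>\<^sub>E carrier F) \<times> ((V - N) \<rightarrow>\<^sub>E carrier F)"
  have \<Phi>_cent: "\<Phi> (f, g) \<in> centralizer a" if f: "f \<in> comps \<rightarrow>\<^sub>E carrier F" and g: "g \<in> (V - N) \<rightarrow>\<^sub>E carrier F" for f g
  proof -
    have fC: "f (C u) \<in> carrier F" if "u \<in> U" for u using PiE_mem[OF f] that by (simp add: comps_def)
    have gN: "g u \<in> carrier F" if "u \<in> V" "u \<notin> N" for u using PiE_mem[OF g] that by simp
    have cl: "\<Phi> (f, g) u \<in> carrier F" if "u \<in> V" for u
      using that aV fC gN by (simp add: \<Phi>_def)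
    \<comment> \<open>The condition is symmetric in the endpoints, so one of them may be assumed in
      \<open>U\<close>; if neither is, both sides vanish.\<close>
    have one_sided: "a u \<otimes> \<Phi> (f, g) w = a w \<otimes> \<Phi> (f, g) u" if uw: "{u, w} \<in> E" and u: "u \<in> U" for u w
    proof (cases "w \<in> U")
      case True
      have "{u, w} \<in> induced_edges E U" using uw u True by (simp add: induced_edges_def)
      then have "(u, w) \<in> R" unfolding R_def by blast
      then have "C u = C w" by (rule C_eq)
      then show ?thesis
        using u True UV aV fC by (simp add: \<Phi>_def subset_iff m_lcomm)
    next
      case False
      have "w \<in> N" using u uw edge_in_V[OF uw] by (auto simp: N_def closed_nbhd_def)
      then show ?thesis
        using False a0 edge_in_V[OF uw] aV cl by (simp add: \<Phi>_def)
    qed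
    have "a u \<otimes> \<Phi> (f, g) w = a w \<otimes> \<Phi> (f, g) u" if uw: "{u, w} \<in> E" for u w
    proof -
      consider "u \<in> U" | "w \<in> U" | "u \<notin> U" "w \<notin> U" by blast
      then show ?thesis
      proof cases
        case 1
        then show ?thesis using one_sided uw by blast
      next
        case 2
        then show ?thesis using one_sided[of w u] uw by (simp add: insert_commute)
      next
        case 3
        then show ?thesis using a0 edge_in_V[OF uw] cl by simp
      qed
    qed
    moreover have "\<Phi> (f, g) \<in> V \<rightarrow>\<^sub>E carrier F"
      using cl by (intro PiE_I) (auto simp: \<Phi>_def)
    ultimately show ?thesis unfolding centralizer_def by blast
  qed
  \<comment> \<open>Along an edge inside the support the condition can be divided by both values of
    \<open>a\<close>, so the quotient of \<open>b\<close> by \<open>a\<close> is constant on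
    paths.\<close>
  have ratio: "inv (a u) \<otimes> b u = inv (a w) \<otimes> b w"
    if b: "b \<in> centralizer a" and "(u, w) \<in> R" "u \<in> U" for b u w
    using that(2)
  proof (induction rule: rtrancl_induct[of u w "{(u, w). {u, w} \<in> induced_edges E U}", folded R_def, consumes 1, case_names base step])
    case base
    show ?case ..
  next
    case (step y z)
    have yz: "y \<in> U" "z \<in> U" "{y, z} \<in> E" using step(2) by (auto simp: induced_edges_def)
    have *: "a y \<otimes> b z = a z \<otimes> b y" using b yz(3) unfolding centralizer_def by blast
    have cl: "a y \<in> carrier F" "a z \<in> carrier F" "b y \<in> carrier F" "b z \<in> carrier F"
      using yz UV aV b by (auto simp: centralizer_def)
    note iy = field_inv[OF cl(1) aU[OF yz(1)]] and iz = field_inv[OF cl(2) aU[OF yz(2)]]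
    have "inv (a y) \<otimes> b y = inv (a y) \<otimes> (inv (a z) \<otimes> (a z \<otimes> b y))"
      using cl iy iz by (simp add: m_assoc[symmetric])
    also have "\<dots> = inv (a z) \<otimes> ((inv (a y) \<otimes> a y) \<otimes> b z)"
      using cl iy(1) iz(1) unfolding *[symmetric] by (simp add: m_lcomm m_assoc)
    also have "\<dots> = inv (a z) \<otimes> b z" using cl iy by simp
    finally show ?case using step(3) by simp
  qed
  have "bij_betw \<Phi> ?D (centralizer a)"
  proof (rule bij_betw_byWitness[where f' = \<Psi>])
    show "\<forall>x\<in>?D. \<Psi> (\<Phi> x) = x"
    proof
      fix x assume "x \<in> ?D"
      then obtain f g where x: "x = (f, g)" and f: "f \<in> comps \<rightarrow>\<^sub>E carrier F" and g: "g \<in> (V - N) \<rightarrow>\<^sub>E carrier F"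
        by auto
      have "fst (\<Psi> (\<Phi> (f, g))) = f"
      proof (rule PiE_ext[OF _ f])
        fix X assume X: "X \<in> comps"
        then obtain u where u: "u \<in> U" "X = C u" by (auto simp: comps_def)
        have r: "rep X \<in> U" "C (rep X) = X" using rep[of u] C_U u by auto
        have "\<Phi> (f, g) (rep X) = a (rep X) \<otimes> f X" using r UV by (auto simp: \<Phi>_def)
        moreover have "f X \<in> carrier F" using PiE_mem[OF f X] .
        ultimately show "fst (\<Psi> (\<Phi> (f, g))) X = f X"
          using X field_inv[of "a (rep X)"] aU[OF r(1)] aV r(1) UV
          by (auto simp: \<Psi>_def m_assoc[symmetric])
      next
        have "inv (a (rep X)) \<otimes> \<Phi> (f, g) (rep X) \<in> carrier F" if X: "X \<in> comps" for X
        proof -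
          obtain u where u: "u \<in> U" "X = C u" using X by (auto simp: comps_def)
          have r: "rep X \<in> U" using rep[of u] C_U u by auto
          moreover have "\<Phi> (f, g) (rep X) \<in> carrier F"
            using \<Phi>_cent[OF f g] r UV by (auto simp: centralizer_def)
          ultimately show ?thesis using field_inv(1)[of "a (rep X)"] aU aV UV by auto
        qed
        then show "fst (\<Psi> (\<Phi> (f, g))) \<in> comps \<rightarrow>\<^sub>E carrier F" by (simp add: \<Psi>_def)
      qed
      moreover have "snd (\<Psi> (\<Phi> (f, g))) = g"
      proof (rule PiE_ext[OF _ g])
        show "snd (\<Psi> (\<Phi> (f, g))) \<in> (V - N) \<rightarrow>\<^sub>E carrier F"
          using \<Phi>_cent[OF f g] by (auto simp: \<Psi>_def centralizer_def)
        fix u assume "u \<in> V - N"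
        then show "snd (\<Psi> (\<Phi> (f, g))) u = g u"
          using UN by (auto simp: \<Psi>_def \<Phi>_def)
      qed
      ultimately show "\<Psi> (\<Phi> x) = x" unfolding x by (simp add: prod_eq_iff)
    qed
    show "\<Phi> ` ?D \<subseteq> centralizer a" using \<Phi>_cent by auto
    have \<Psi>_D: "\<Psi> b \<in> ?D" if b: "b \<in> centralizer a" for b
    proof -
      have bV: "b u \<in> carrier F" if "u \<in> V" for u using b that by (auto simp: centralizer_def)
      have "inv (a (rep X)) \<otimes> b (rep X) \<in> carrier F" if X: "X \<in> comps" for X
      proof -
        obtain u where u: "u \<in> U" "X = C u" using X by (auto simp: comps_def)
        have r: "rep X \<in> U" using rep[of u] C_U u by auto
        then show ?thesis using field_inv(1)[of "a (rep X)"] aU aV UV bV by auto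
      qed
      then show ?thesis using bV by (simp add: \<Psi>_def)
    qed
    then show "\<Psi> ` centralizer a \<subseteq> ?D" by blast
    show "\<forall>b\<in>centralizer a. \<Phi> (\<Psi> b) = b"
    proof
      fix b assume b: "b \<in> centralizer a"
      then have bV: "b \<in> V \<rightarrow>\<^sub>E carrier F" by (simp add: centralizer_def)
      show "\<Phi> (\<Psi> b) = b"
      proof (rule PiE_ext[OF _ bV])
        show "\<Phi> (\<Psi> b) \<in> V \<rightarrow>\<^sub>E carrier F"
          using \<Psi>_D[OF b] \<Phi>_cent by (cases "\<Psi> b") (auto simp: centralizer_def)
        fix u assume u: "u \<in> V"
        consider "u \<in> U" | "u \<in> N" "u \<notin> U" | "u \<notin> N" by blast
        then show "\<Phi> (\<Psi> b) u = b u"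
        proof cases
          case 1
          have "\<Phi> (\<Psi> b) u = a u \<otimes> (inv (a (rep (C u))) \<otimes> b (rep (C u)))"
            using 1 u by (simp add: \<Phi>_def \<Psi>_def comps_def)
          also have "\<dots> = a u \<otimes> (inv (a u) \<otimes> b u)"
            using ratio[OF b rep(3) 1] by simp
          also have "\<dots> = b u"
            using field_inv[OF aV[OF u] aU[OF 1]] aV[OF u] PiE_mem[OF bV u]
            by (simp add: m_assoc[symmetric])
          finally show ?thesis .
        next
          case 2
          \<comment> \<open>A neighbour in the support turns the condition into
            \<open>a w \<otimes> b u = \<zero>\<close> with \<open>a w\<close> nonzero, and a field
            has no zero divisors.\<close>
          then obtain w where w: "w \<in> U" "{w, u} \<in> E" by (auto simp: N_def closed_nbhd_def)
          have cl: "a w \<in> carrier F" "b w \<in> carrier F" "b u \<in> carrier F"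
            using w UV aV PiE_mem[OF bV] u by auto
          have "a w \<otimes> b u = a u \<otimes> b w" using b w(2) unfolding centralizer_def by blast
          also have "\<dots> = \<zero>" using a0[OF u 2(2)] cl by simp
          finally have "b u = \<zero>" using integral[of "a w" "b u"] aU[OF w(1)] cl by blast
          then show ?thesis using 2 u by (simp add: \<Phi>_def \<Psi>_def)
        next
          case 3
          then have "u \<notin> U" using UN by auto
          then show ?thesis using 3 u by (simp add: \<Phi>_def \<Psi>_def)
        qed
      qed
    qed
  qed
  then have "card (centralizer a) = card ?D" by (rule bij_betw_same_card[symmetric])
  moreover have "finite comps" using finite_subset[OF UV finite_V] by (simp add: comps_def)
  moreover have "card (V - N) = n - card N"
    using card_Diff_subset[of N V] NV finite_subset[OF NV finite_V] bij_betw_same_card[OF enum] by simp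
  ultimately show ?thesis
    by (simp add: card_cartesian_product card_PiE finite_V power_add num_components_def comps
        flip: U_def N_def)
qed

section \<open>Class sizes and counting by support\<close>

abbreviation "q \<equiv> card (carrier F)"
abbreviation "nbhd U \<equiv> closed_nbhd V E U"

lemma q_gt_1: "1 < q"
proof -
  have "card {\<zero>, \<one>} \<le> q" by (intro card_mono finite_carrier) auto
  then show ?thesis by simp
qed

lemma card_nbhd_le: "card (nbhd U) \<le> n"
proof -
  have "card (nbhd U) \<le> card V" by (intro card_mono finite_V) (auto simp: closed_nbhd_def)
  then show ?thesis using bij_betw_same_card[OF enum] by simp
qed

lemma finite_conj_class_model: "finite (conj_class model h)"
  unfolding conj_class_def using finite_model by simp

lemma conj_class_model_nonempty: "conj_class model h \<noteq> {}"
  unfolding conj_class_def using M.one_closed by blast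

lemma conj_class_model_subset:
  assumes h: "(a, c) \<in> carrier model"
  shows "conj_class model (a, c) \<subseteq> {a} \<times> (J \<rightarrow>\<^sub>E carrier F)"
proof
  fix y assume "y \<in> conj_class model (a, c)"
  then obtain g where g: "g \<in> carrier model" "y = g \<otimes>\<^bsub>model\<^esub> (a, c) \<otimes>\<^bsub>model\<^esub> inv\<^bsub>model\<^esub> g"
    by (auto simp: conj_class_def)
  then have y: "y \<in> carrier model" using h by simp
  \<comment> \<open>Comparing first coordinates of \<open>y g = g h\<close> instead of
    \<open>y = g h g^-1\<close> keeps inverses of the model out of the computation.\<close>
  have eq: "y \<otimes>\<^bsub>model\<^esub> g = g \<otimes>\<^bsub>model\<^esub> (a, c)" using g h by (simp add: M.m_assoc)
  have Fy: "fst y \<in> V \<rightarrow>\<^sub>E carrier F" and Fg: "fst g \<in> V \<rightarrow>\<^sub>E carrier F" and Fa: "a \<in> V \<rightarrow>\<^sub>E carrier F"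
    using y g(1) h by (auto simp: model_simps(1))
  have "fst y = a"
  proof (rule PiE_ext[OF Fy Fa])
    fix u assume u: "u \<in> V"
    have "fst y u \<oplus> fst g u = fst g u \<oplus> a u"
      using arg_cong[OF eq, of "\<lambda>x. fst x u"] u by (simp add: fst_model_mult)
    then show "fst y u = a u"
      unfolding a_comm[OF PiE_mem[OF Fg u] PiE_mem[OF Fa u]]
      using PiE_mem[OF Fy u] PiE_mem[OF Fg u] PiE_mem[OF Fa u] by simp
  qed
  then show "y \<in> {a} \<times> (J \<rightarrow>\<^sub>E carrier F)"
    using y by (cases y) (simp add: model_simps(1))
qed

text \<open>The exponent is a truncated difference, so its formula needs the bounds, and the class
  supplies them: being nonempty, it forces q^c(U) \<le> q^|N[U]|; lying in a fibre of size q^m, it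
  has exponent at most m.\<close>

lemma class_size:
  assumes h: "(a, c) \<in> carrier model"
  defines "U \<equiv> support a"
  shows "num_components E U \<le> card (nbhd U)"
    and "card (conj_class model (a, c)) = q ^ (card (nbhd U) - num_components E U)"
    and "card (nbhd U) - num_components E U \<le> card E"
proof -
  let ?k = "card (conj_class model (a, c))" and ?c = "num_components E U" and ?N = "card (nbhd U)"
  have a: "a \<in> V \<rightarrow>\<^sub>E carrier F" using h by (simp add: model_simps(1))
  \<comment> \<open>By \<open>card_nbhd_le\<close> the exponent \<open>n\<close> splits as
    \<open>?N + (n - ?N)\<close>, so the contribution of the vertices outside the neighbourhood
    cancels.\<close>
  have "?k * (q ^ ?c * q ^ (n - ?N)) = q ^ ?N * q ^ (n - ?N)"
    using card_conj_class_model[OF h] card_centralizer[OF a] card_nbhd_le[of U]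
    by (simp add: U_def power_add[symmetric])
  then have eq: "?k * q ^ ?c = q ^ ?N" using q_gt_1 by (simp add: mult.assoc[symmetric])
  have "?k \<noteq> 0" using finite_conj_class_model conj_class_model_nonempty by simp
  then have "q ^ ?c \<le> q ^ ?N" using eq[symmetric] by simp
  then show le: "?c \<le> ?N" using q_gt_1 by (simp add: power_increasing_iff)
  then have "?k * q ^ ?c = q ^ (?N - ?c) * q ^ ?c" using eq by (simp add: power_add[symmetric])
  then show k: "?k = q ^ (?N - ?c)" using q_gt_1 by simp
  have "?k \<le> card ({a} \<times> (J \<rightarrow>\<^sub>E carrier F))"
    using finite_J finite_carrier by (intro card_mono conj_class_model_subset h) (simp add: finite_PiE)
  also have "\<dots> = q ^ card E" by (simp add: card_cartesian_product card_PiE finite_J card_J)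
  finally show "?N - ?c \<le> card E" unfolding k using q_gt_1 by (simp add: power_increasing_iff)
qed

text \<open>A purely graph-theoretic statement obtained from group theory: every \<open>U\<close> is
  the support of its indicator function, so the bounds on class sizes apply to it.\<close>

lemma exponent_bounds:
  assumes "U \<subseteq> V"
  shows "num_components E U \<le> card (nbhd U)" "card (nbhd U) - num_components E U \<le> card E"
proof -
  let ?a = "\<lambda>u\<in>V. if u \<in> U then \<one> else \<zero>"
  have h: "(?a, \<lambda>p\<in>J. \<zero>) \<in> carrier model" by (simp add: model_simps(1))
  have "support ?a = U" using assms by (auto simp: support_def)
  then show "num_components E U \<le> card (nbhd U)" "card (nbhd U) - num_components E U \<le> card E"
    using class_size(1,3)[OF h] by simp_all
qed

lemma card_support_eq:
  assumes "U \<subseteq> V"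
  shows "card {a \<in> V \<rightarrow>\<^sub>E carrier F. support a = U} = (q - 1) ^ card U"
proof -
  have "{a \<in> V \<rightarrow>\<^sub>E carrier F. support a = U} =
      (\<Pi>\<^sub>E u\<in>V. if u \<in> U then carrier F - {\<zero>} else {\<zero>})" (is "?L = ?R")
  proof (intro equalityI subsetI)
    fix a assume "a \<in> ?L"
    then show "a \<in> ?R" by (auto simp: support_def PiE_iff)
  next
    fix a assume a: "a \<in> ?R"
    then have *: "a u \<in> (if u \<in> U then carrier F - {\<zero>} else {\<zero>})" if "u \<in> V" for u
      using that by (rule PiE_mem)
    have "a \<in> V \<rightarrow>\<^sub>E carrier F"
    proof (rule PiE_I)
      show "a u \<in> carrier F" if "u \<in> V" for u
        using *[OF that] by (cases "u \<in> U") auto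
      show "a u = undefined" if "u \<notin> V" for u using a that by (rule PiE_arb)
    qed
    moreover have "support a = U"
    proof (intro equalityI subsetI)
      fix u assume "u \<in> support a"
      then show "u \<in> U" using *[of u] by (auto simp: support_def split: if_splits)
    next
      fix u assume "u \<in> U"
      then show "u \<in> support a" using *[of u] assms by (auto simp: support_def)
    qed
    ultimately show "a \<in> ?L" by simp
  qed
  moreover have "card ?R = (\<Prod>u\<in>V. if u \<in> U then q - 1 else 1)"
    using finite_carrier by (simp add: card_PiE finite_V if_distrib[of card] cong: prod.cong if_cong)
  moreover have "\<dots> = (\<Prod>u\<in>U. q - 1)"
    using assms finite_V by (simp add: prod.If_cases Int_absorb1 Collect_mem_eq)
  ultimately show ?thesis by simp
qed

lemma cc_model:
  "cc (q ^ i) model =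
    (\<Sum>U | U \<subseteq> V \<and> card (nbhd U) - num_components E U = i.
      (q - 1) ^ card U * q ^ (card E + num_components E U - card (nbhd U)))" (is "_ = sum ?f ?\<U>")
proof -
  let ?H = "\<lambda>U. {a \<in> V \<rightarrow>\<^sub>E carrier F. support a = U} \<times> (J \<rightarrow>\<^sub>E carrier F)"
  have fin: "finite ?\<U>" using finite_V by simp
  have "{h \<in> carrier model. card (conj_class model h) = q ^ i} = (\<Union>U\<in>?\<U>. ?H U)" (is "?S = _")
  proof (intro equalityI subsetI)
    fix h assume h: "h \<in> ?S"
    obtain a c where ac: "h = (a, c)" by (cases h)
    \<comment> \<open>As q > 1, the size of a class determines its exponent.\<close>
    have "card (nbhd (support a)) - num_components E (support a) = i"
      using h class_size(2)[of a c] q_gt_1 by (simp add: ac)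
    moreover have "support a \<subseteq> V" by (auto simp: support_def)
    ultimately show "h \<in> (\<Union>U\<in>?\<U>. ?H U)"
      using h by (intro UN_I[of "support a"]) (simp_all add: ac model_simps(1))
  next
    fix h assume "h \<in> (\<Union>U\<in>?\<U>. ?H U)"
    then obtain U where U: "U \<in> ?\<U>" "h \<in> ?H U" by blast
    obtain a c where ac: "h = (a, c)" by (cases h)
    have "h \<in> carrier model" using U by (simp add: ac model_simps(1))
    then show "h \<in> ?S"
      using U class_size(2)[of a c] by (simp add: ac)
  qed
  moreover have "card (\<Union>U\<in>?\<U>. ?H U) = (\<Sum>U\<in>?\<U>. card (?H U))"
  proof (rule card_UN_disjoint[OF fin])
    show "\<forall>U\<in>?\<U>. finite (?H U)"
      using finite_V finite_J finite_carrier by (simp add: finite_PiE)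
    show "\<forall>U\<in>?\<U>. \<forall>U'\<in>?\<U>. U \<noteq> U' \<longrightarrow> ?H U \<inter> ?H U' = {}" by blast
  qed
  moreover have "card (?H U) = q ^ i * ?f U" if "U \<in> ?\<U>" for U
  proof -
    \<comment> \<open>Both bounds enter here, so that no truncation occurs. The class size q^i
      splits off from q^m, leaving the power of q in the polynomial, and is cancelled at the
      end.\<close>
    have "card E = i + (card E + num_components E U - card (nbhd U))"
      using that exponent_bounds[of U] by auto
    then have "q ^ card E = q ^ i * q ^ (card E + num_components E U - card (nbhd U))"
      by (metis power_add)
    then show ?thesis
      using that by (simp add: card_cartesian_product card_support_eq card_PiE finite_J card_J)
  qed
  ultimately have "q ^ i * cc (q ^ i) model = q ^ i * sum ?f ?\<U>"
    using M.card_conj_class_times_cc[OF finite_model, of "q ^ i"] by (simp add: sum_distrib_left)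
  then show ?thesis using q_gt_1 by simp
qed

lemma cc_graphical_group: "cc e G = cc e model"
proof -
  obtain \<psi> where "\<psi> \<in> iso G model" using graphical_group_iso_model by blast
  then show ?thesis by (rule cc_iso[OF GG.is_group M.is_group])
qed

lemma coeff_eval_class_size_poly:
  "coeff (eval_X (int q) (class_size_poly V E)) i = int (cc (q ^ i) G)"
proof -
  let ?e = "\<lambda>U. card (nbhd U) - num_components E U"
  let ?d = "\<lambda>U. card E + num_components E U - card (nbhd U)"
  have "coeff (eval_X (int q) (class_size_poly V E)) i =
      (\<Sum>U\<in>Pow V. poly (if ?e U = i then ([:0, 1:] - 1) ^ card U * [:0, 1:] ^ ?d U else 0) (int q))"
    by (simp add: eval_X_def class_size_poly_def Let_def coeff_map_poly coeff_sum poly_sum)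
  also have "\<dots> = (\<Sum>U\<in>Pow V. if ?e U = i then (int q - 1) ^ card U * int q ^ ?d U else 0)"
    by (intro sum.cong) simp_all
  also have "\<dots> = (\<Sum>U | U \<subseteq> V \<and> ?e U = i. (int q - 1) ^ card U * int q ^ ?d U)"
    using finite_V by (simp add: sum.inter_filter[symmetric])
  \<comment> \<open>The polynomial uses the integer q - 1 and the count the natural number; they
    agree because q > 1.\<close>
  also have "\<dots> = int (cc (q ^ i) G)"
    using q_gt_1 by (simp add: cc_graphical_group cc_model of_nat_diff)
  finally show ?thesis .
qed

end

text \<open>\<open>Sum_any\<close> is meaningful only for finitely many nonzero terms; those beyond
  the degree vanish. This reduces the theorem to a comparison of coefficients.\<close>

lemma Sum_any_monom_coeff:
  fixes p :: "'a :: comm_monoid_add poly"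
  shows "Sum_any (\<lambda>i. monom (coeff p i) i) = p"
proof -
  have "Sum_any (\<lambda>i. monom (coeff p i) i) = (\<Sum>i\<le>degree p. monom (coeff p i) i)"
  proof (rule Sum_any.expand_superset)
    show "{i. monom (coeff p i) i \<noteq> 0} \<subseteq> {..degree p}"
      using le_degree by fastforce
  qed simp
  then show ?thesis by (simp add: poly_as_sum_of_monoms)
qed

theorem theorem1:
  fixes V :: "'v set" and E :: "'v set set" and n :: nat and v :: "nat \<Rightarrow> 'v"
    and q :: nat and F :: "('r, 'm) ring_scheme"
  assumes "finite_simple_graph V E"
    and "bij_betw v {1..n} V"
    and "primepow q"
    and "field F" and "card (carrier F) = q"
  shows "eval_X (int q) (class_size_poly V E) =
    Sum_any (\<lambda>i. monom (int (cc (q ^ i) (graphical_group n v E F))) i)"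
proof -
  \<comment> \<open>An infinite set has \<open>card\<close> equal to 0, so a positive cardinality
    makes the field finite.\<close>
  have "q > 0" using assms(3) by (rule primepow_gt_0_nat)
  then have "finite (carrier F)" using assms(5) card_ge_0_finite by metis
  then interpret graphical F V E n v
    using assms by (intro graphical.intro graphical_axioms.intro)
  show ?thesis
    using Sum_any_monom_coeff[of "eval_X (int q) (class_size_poly V E)"]
      coeff_eval_class_size_poly assms(5) by simp
qed

end
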